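(* Consider the fully discrete ensemble scheme defined in the context, with $\nu,\nu_m>0$, $\alpha:=\nu+\nu_m-|\nu-\nu_m|>0$, time step $\Delta t>0$, end time $T=M\Delta t$, initial data $v_{j,h}^0,v_{j,h}^1,w_{j,h}^0,w_{j,h}^1\in V_h$ and forcings $f_{1,j},f_{2,j}\in L^\infty(0,T;H^{-1}(\Omega)^d)$, $j=1,\dots,J$. Suppose the mesh is sufficiently regular that the inverse inequality $\|\nabla u_h\|\le C_i h^{-1}\|u_h\|$ holds for all $u_h\in X_h$, and let $C_*$ be a constant with $|(u\cdot\nabla v,w)|\le C_*\|\nabla u\|\,\|\nabla v\|\,\|\nabla w\|$ for all $u,v,w\in X$. Suppose that for every $n=1,\dots,M-1$ the time step satisfies $$\Delta t\le \frac{\alpha h^2}{3(\nu-\nu_m)^2C_i^2+12\,C_*^2C_i^2\max\limits_{1\le j\le J}\big\{\|\nabla v_{j,h}^{'n}\|^2,\|\nabla w_{j,h}^{'n}\|^2\big\}}$$ (no restriction if the denominator is zero). Then the method is stable: for every $j=1,\dots,J$ the solutions of the scheme satisfy $$\begin{aligned} &\|v_{j,h}^M\|^2+\|w_{j,h}^M\|^2+\|2v_{j,h}^M-v_{j,h}^{M-1}\|^2+\|2w_{j,h}^M-w_{j,h}^{M-1}\|^2+\alpha\Delta t\sum_{n=1}^{M-1}\big(\|\nabla v_{j,h}^{n+1}\|^2+\|\nabla w_{j,h}^{n+1}\|^2\big)\\ &\le \|v_{j,h}^1\|^2+\|w_{j,h}^1\|^2+\|2v_{j,h}^1-v_{j,h}^0\|^2+\|2w_{j,h}^1-w_{j,h}^0\|^2+\frac{12\Delta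 t}{\alpha}\sum_{n=1}^{M-1}\big(\|f_{1,j}(t^{n+1})\|_{-1}^2+\|f_{2,j}(t^{n+1})\|_{-1}^2\big). \end{aligned}$$
   Context: $\Omega\subset\mathbb{R}^d$ ($d=2,3$) is a convex polygonal or polyhedral domain. $\|\cdot\|$ and $(\cdot,\cdot)$ are the $L^2(\Omega)$ norm and inner product (or the duality pairing when the first argument lies in $H^{-1}$). $X:=H_0^1(\Omega)^d$, $Q:=L_0^2(\Omega)$, and $\|f\|_{-1}:=\sup_{0\ne\phi\in X}(f,\phi)/\|\nabla\phi\|$. $X_h\subset X$ and $Q_h\subset Q$ are conforming finite element spaces on a regular triangulation of mesh size $h$ (the pair $(P_k,P_{k-1})$ of continuous piecewise degree-$k$ velocities and degree-$(k-1)$ pressures), satisfying the discrete inf-sup condition $\inf_{q_h\in Q_h}\sup_{v_h\in X_h}\frac{(q_h,\nabla\cdot v_h)}{\|q_h\|\|\nabla v_h\|}\ge\beta>0$ with $\beta$ independent of $h$. $V_h:=\{v_h\in X_h:(\nabla\cdot v_h,q_h)=0\ \forall q_h\in Q_h\}$. The elements are divergence-free, i.e. $\nabla\cdot v_h=0$ for all $v_h\in V_h$, so that $(u_h\cdot\nabla v,v)=0$ for $u_h\in V_h$, $v\in X$. Ensemble mean and fluctuation: for a family $(u_j^n)$, $j=1,\dots,J$, $$\langle u\rangle^n:=\frac1J\sum_{j=1}^J(2u_j^n-u_j^{n-1}),\qquad u_j^{'n}:=2u_j^n-u_j^{n-1}-\langle u\rangle^n .$$ Scheme: with $t^n=n\Delta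 t$, given $v_{j,h}^0,v_{j,h}^1,w_{j,h}^0,w_{j,h}^1\in V_h$, for $n=1,\dots,M-1$ and each $j=1,\dots,J$ find $v_{j,h}^{n+1},w_{j,h}^{n+1}\in V_h$ such that for all $\chi_h,l_h\in V_h$ $$\Big(\tfrac{3v_{j,h}^{n+1}-4v_{j,h}^n+v_{j,h}^{n-1}}{2\Delta t},\chi_h\Big)+\tfrac{\nu+\nu_m}{2}(\nabla v_{j,h}^{n+1},\nabla\chi_h)+\tfrac{\nu-\nu_m}{2}(\nabla(2w_{j,h}^n-w_{j,h}^{n-1}),\nabla\chi_h)+(\langle w_h\rangle^n\cdot\nabla v_{j,h}^{n+1},\chi_h)+(w_{j,h}^{'n}\cdot\nabla(2v_{j,h}^n-v_{j,h}^{n-1}),\chi_h)=(f_{1,j}(t^{n+1}),\chi_h),$$ $$\Big(\tfrac{3w_{j,h}^{n+1}-4w_{j,h}^n+w_{j,h}^{n-1}}{2\Delta t},l_h\Big)+\tfrac{\nu+\nu_m}{2}(\nabla w_{j,h}^{n+1},\nabla l_h)+\tfrac{\nu-\nu_m}{2}(\nabla(2v_{j,h}^n-v_{j,h}^{n-1}),\nabla l_h)+(\langle v_h\rangle^n\cdot\nabla w_{j,h}^{n+1},l_h)+(v_{j,h}^{'n}\cdot\nabla(2w_{j,h}^n-w_{j,h}^{n-1}),l_h)=(f_{2,j}(t^{n+1}),l_h).$$ *)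

theory Defs
  imports "HOL-Analysis.Analysis"
begin

section \<open>Square-integrable functions\<close>

text \<open>
  Elements of function spaces over \<open>\<Omega>\<close> are represented by functions on the whole space, of which
  only the restriction to \<open>\<Omega>\<close>, up to null sets, is relevant.
\<close>

definition L2 :: "(real^'d) set \<Rightarrow> (real^'d \<Rightarrow> 'b::euclidean_space) set" where
  "L2 \<Omega> = {u. u \<in> borel_measurable (lebesgue_on \<Omega>) \<and>
              integrable (lebesgue_on \<Omega>) (\<lambda>x. (norm (u x))\<^sup>2)}"

definition ip :: "(real^'d) set \<Rightarrow> (real^'d \<Rightarrow> 'b::euclidean_space) \<Rightarrow> (real^'d \<Rightarrow> 'b) \<Rightarrow> real" where
  "ip \<Omega> u v = (LINT x|lebesgue_on \<Omega>. u x \<bullet> v x)"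

definition nrm :: "(real^'d) set \<Rightarrow> (real^'d \<Rightarrow> 'b::euclidean_space) \<Rightarrow> real" where
  "nrm \<Omega> u = sqrt (LINT x|lebesgue_on \<Omega>. (norm (u x))\<^sup>2)"

definition nonzero_on :: "(real^'d) set \<Rightarrow> (real^'d \<Rightarrow> 'b::euclidean_space) \<Rightarrow> bool" where
  "nonzero_on \<Omega> u \<longleftrightarrow> \<not> (AE x in lebesgue_on \<Omega>. u x = 0)"

definition L2_0 :: "(real^'d) set \<Rightarrow> (real^'d \<Rightarrow> real) set" where
  "L2_0 \<Omega> = {q \<in> L2 \<Omega>. (LINT x|lebesgue_on \<Omega>. q x) = 0}"

section \<open>Weak derivatives and Sobolev spaces\<close>

definition partial :: "'d \<Rightarrow> (real^'d \<Rightarrow> real) \<Rightarrow> real^'d \<Rightarrow> real" where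
  "partial i \<phi> x = frechet_derivative \<phi> (at x) (axis i 1)"

primrec C_k :: "nat \<Rightarrow> (real^'d \<Rightarrow> real) \<Rightarrow> bool" where
  "C_k 0 \<phi> \<longleftrightarrow> continuous_on UNIV \<phi>"
| "C_k (Suc k) \<phi> \<longleftrightarrow> (\<forall>x. \<phi> differentiable (at x)) \<and> (\<forall>i. C_k k (partial i \<phi>))"

definition test_fun :: "(real^'d) set \<Rightarrow> (real^'d \<Rightarrow> real) set" where
  "test_fun \<Omega> = {\<phi>. (\<forall>k. C_k k \<phi>) \<and> compact (closure {x. \<phi> x \<noteq> 0}) \<and> closure {x. \<phi> x \<noteq> 0} \<subseteq> \<Omega>}"

definition has_weak_grad :: "(real^'d) set \<Rightarrow> (real^'d \<Rightarrow> real) \<Rightarrow> (real^'d \<Rightarrow> real^'d) \<Rightarrow> bool" where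
  "has_weak_grad \<Omega> u g \<longleftrightarrow>
     (\<forall>\<phi>\<in>test_fun \<Omega>. \<forall>i.
        (LINT x|lebesgue_on \<Omega>. u x * partial i \<phi> x) = - (LINT x|lebesgue_on \<Omega>. g x $ i * \<phi> x))"

definition H1 :: "(real^'d) set \<Rightarrow> (real^'d \<Rightarrow> real) set" where
  "H1 \<Omega> = {u \<in> L2 \<Omega>. \<exists>g\<in>L2 \<Omega>. has_weak_grad \<Omega> u g}"

text \<open>The weak gradient is determined only almost everywhere; any representative is chosen.\<close>

definition weak_grad :: "(real^'d) set \<Rightarrow> (real^'d \<Rightarrow> real) \<Rightarrow> real^'d \<Rightarrow> real^'d" where
  "weak_grad \<Omega> u = (SOME g. g \<in> L2 \<Omega> \<and> has_weak_grad \<Omega> u g)"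

definition H1_norm :: "(real^'d) set \<Rightarrow> (real^'d \<Rightarrow> real) \<Rightarrow> real" where
  "H1_norm \<Omega> u = sqrt ((nrm \<Omega> u)\<^sup>2 + (nrm \<Omega> (weak_grad \<Omega> u))\<^sup>2)"

definition H1_0 :: "(real^'d) set \<Rightarrow> (real^'d \<Rightarrow> real) set" where
  "H1_0 \<Omega> = {u \<in> H1 \<Omega>. \<exists>\<phi>. (\<forall>n::nat. \<phi> n \<in> test_fun \<Omega>) \<and>
                (\<lambda>n. H1_norm \<Omega> (\<lambda>x. \<phi> n x - u x)) \<longlonglongrightarrow> 0}"

definition Xsp :: "(real^'d) set \<Rightarrow> (real^'d \<Rightarrow> real^'d) set" where
  "Xsp \<Omega> = {v. \<forall>i. (\<lambda>x. v x $ i) \<in> H1_0 \<Omega>}"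

text \<open>
  The entry in row \<open>i\<close>, column \<open>j\<close> of \<open>grad \<Omega> v x\<close> is the \<open>j\<close>-th partial derivative of the \<open>i\<close>-th
  component of \<open>v\<close>. The norm and the inner product on matrices are those of Frobenius.
\<close>

definition grad :: "(real^'d) set \<Rightarrow> (real^'d \<Rightarrow> real^'d) \<Rightarrow> real^'d \<Rightarrow> real^'d^'d" where
  "grad \<Omega> v x = (\<chi> i. weak_grad \<Omega> (\<lambda>y. v y $ i) x)"

definition dvg :: "(real^'d) set \<Rightarrow> (real^'d \<Rightarrow> real^'d) \<Rightarrow> real^'d \<Rightarrow> real" where
  "dvg \<Omega> v x = trace (grad \<Omega> v x)"

definition conv :: "(real^'d) set \<Rightarrow> (real^'d \<Rightarrow> real^'d) \<Rightarrow> (real^'d \<Rightarrow> real^'d) \<Rightarrow> real^'d \<Rightarrow> real^'d" where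
  "conv \<Omega> u v x = grad \<Omega> v x *v u x"  \<comment> \<open>the field \<open>(u \<cdot> \<nabla>) v\<close>\<close>

section \<open>The dual space and forcings\<close>

definition Hminus1 :: "(real^'d) set \<Rightarrow> ((real^'d \<Rightarrow> real^'d) \<Rightarrow> real) set" where
  "Hminus1 \<Omega> = {F. (\<forall>\<phi>\<in>Xsp \<Omega>. \<forall>\<psi>\<in>Xsp \<Omega>. F (\<lambda>x. \<phi> x + \<psi> x) = F \<phi> + F \<psi>) \<and>
                  (\<forall>c. \<forall>\<phi>\<in>Xsp \<Omega>. F (\<lambda>x. c *\<^sub>R \<phi> x) = c * F \<phi>) \<and>
                  (\<exists>C. \<forall>\<phi>\<in>Xsp \<Omega>. \<bar>F \<phi>\<bar> \<le> C * nrm \<Omega> (grad \<Omega> \<phi>))}"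

definition dual_norm :: "(real^'d) set \<Rightarrow> ((real^'d \<Rightarrow> real^'d) \<Rightarrow> real) \<Rightarrow> real" where
  "dual_norm \<Omega> F = (SUP \<phi>\<in>{\<phi>\<in>Xsp \<Omega>. nonzero_on \<Omega> \<phi>}. F \<phi> / nrm \<Omega> (grad \<Omega> \<phi>))"

text \<open>
  Membership in \<open>L\<^sup>\<infinity>(0,T;H\<^sup>-\<^sup>1)\<close>: strongly measurable (Bochner) and essentially bounded. Point
  values are needed by the time stepping, at the times in \<open>(0,T]\<close>, so a representative with values
  in the dual space at all these times is given.
\<close>

definition Linf_Hminus1 ::
    "(real^'d) set \<Rightarrow> real \<Rightarrow> (real \<Rightarrow> (real^'d \<Rightarrow> real^'d) \<Rightarrow> real) set" where
  "Linf_Hminus1 \<Omega> T = {f. (\<forall>t\<in>{0<..T}. f t \<in> Hminus1 \<Omega>) \<and>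
     (\<exists>s. (\<forall>n::nat. simple_function (lebesgue_on {0<..<T}) (s n) \<and> (\<forall>t\<in>{0<..<T}. s n t \<in> Hminus1 \<Omega>)) \<and>
          (AE t in lebesgue_on {0<..<T}.
             (\<lambda>n. dual_norm \<Omega> (\<lambda>\<phi>. s n t \<phi> - f t \<phi>)) \<longlonglongrightarrow> 0)) \<and>
     (\<exists>C. AE t in lebesgue_on {0<..<T}. dual_norm \<Omega> (f t) \<le> C)}"

section \<open>Domain, mesh and finite element spaces\<close>

definition convex_polytopal_domain :: "(real^'d) set \<Rightarrow> bool" where
  "convex_polytopal_domain \<Omega> \<longleftrightarrow> open \<Omega> \<and> \<Omega> \<noteq> {} \<and> convex \<Omega> \<and> polytope (closure \<Omega>)"

text \<open>
  The library's \<^const>\<open>triangulation\<close> requires that any two cells meet in a common face. Shape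
  regularity does not appear: for one finite mesh it holds with some constant.
\<close>

definition mesh_of :: "(real^'d) set \<Rightarrow> (real^'d) set set \<Rightarrow> bool" where
  "mesh_of \<Omega> \<T> \<longleftrightarrow> triangulation \<T> \<and> (\<forall>K\<in>\<T>. int CARD('d) simplex K) \<and> \<Union>\<T> = closure \<Omega>"

definition mesh_size :: "(real^'d) set set \<Rightarrow> real" where
  "mesh_size \<T> = Max (diameter ` \<T>)"

definition poly_le :: "nat \<Rightarrow> (real^'d \<Rightarrow> real) set" where
  "poly_le k = {p. \<exists>c. \<forall>x. p x = (\<Sum>a | sum a UNIV \<le> k. c a * (\<Prod>i\<in>UNIV. (x $ i) ^ (a i)))}"
    \<comment> \<open>total degree at most \<open>k\<close>; \<open>a\<close> ranges over multi-indices\<close>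

definition velocity_space :: "(real^'d) set \<Rightarrow> (real^'d) set set \<Rightarrow> nat \<Rightarrow> (real^'d \<Rightarrow> real^'d) set" where
  "velocity_space \<Omega> \<T> k = {v \<in> Xsp \<Omega>. continuous_on (closure \<Omega>) v \<and>
     (\<forall>K\<in>\<T>. \<forall>i. \<exists>p\<in>poly_le k. \<forall>x\<in>K. v x $ i = p x)}"

text \<open>
  Discontinuous pressures (Scott-Vogelius pair) are given by \<open>pressure_space\<close>, continuous ones by
  \<open>cont_pressure_space\<close>.
\<close>

definition pressure_space :: "(real^'d) set \<Rightarrow> (real^'d) set set \<Rightarrow> nat \<Rightarrow> (real^'d \<Rightarrow> real) set" where
  "pressure_space \<Omega> \<T> m = {q \<in> L2_0 \<Omega>. \<forall>K\<in>\<T>. \<exists>p\<in>poly_le m. \<forall>x\<in>interior K. q x = p x}"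

definition cont_pressure_space :: "(real^'d) set \<Rightarrow> (real^'d) set set \<Rightarrow> nat \<Rightarrow> (real^'d \<Rightarrow> real) set" where
  "cont_pressure_space \<Omega> \<T> m = {q \<in> pressure_space \<Omega> \<T> m. continuous_on (closure \<Omega>) q}"

text \<open>Infimum and supremum are taken in the extended reals, so that they always exist.\<close>

definition inf_sup ::
    "(real^'d) set \<Rightarrow> (real^'d \<Rightarrow> real^'d) set \<Rightarrow> (real^'d \<Rightarrow> real) set \<Rightarrow> real \<Rightarrow> bool" where
  "inf_sup \<Omega> Xh Qh \<beta> \<longleftrightarrow>
     ereal \<beta> \<le> (INF q\<in>{q\<in>Qh. nonzero_on \<Omega> q}. SUP v\<in>{v\<in>Xh. nonzero_on \<Omega> v}.
                  ereal (ip \<Omega> q (dvg \<Omega> v) / (nrm \<Omega> q * nrm \<Omega> (grad \<Omega> v))))"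

definition Vsp ::
    "(real^'d) set \<Rightarrow> (real^'d \<Rightarrow> real^'d) set \<Rightarrow> (real^'d \<Rightarrow> real) set \<Rightarrow> (real^'d \<Rightarrow> real^'d) set" where
  "Vsp \<Omega> Xh Qh = {v\<in>Xh. \<forall>q\<in>Qh. ip \<Omega> (dvg \<Omega> v) q = 0}"

section \<open>The ensemble scheme\<close>

text \<open>
  A family \<open>u j n\<close> is indexed by the ensemble member \<open>j\<close> and the time level \<open>n\<close>. The index
  \<open>n - 1\<close> below is only used for \<open>n \<ge> 1\<close>.
\<close>

type_synonym 'd family = "nat \<Rightarrow> nat \<Rightarrow> real^'d \<Rightarrow> real^'d"

definition extrap :: "'d::finite family \<Rightarrow> nat \<Rightarrow> nat \<Rightarrow> real^'d \<Rightarrow> real^'d" where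
  "extrap u j n x = 2 *\<^sub>R u j n x - u j (n - 1) x"

definition ens_mean :: "nat \<Rightarrow> 'd::finite family \<Rightarrow> nat \<Rightarrow> real^'d \<Rightarrow> real^'d" where
  "ens_mean J u n x = (1 / real J) *\<^sub>R (\<Sum>j=1..J. 2 *\<^sub>R u j n x - u j (n - 1) x)"

definition fluct :: "nat \<Rightarrow> 'd::finite family \<Rightarrow> nat \<Rightarrow> nat \<Rightarrow> real^'d \<Rightarrow> real^'d" where
  "fluct J u j n x = 2 *\<^sub>R u j n x - u j (n - 1) x - ens_mean J u n x"

definition BDF2 :: "real \<Rightarrow> 'd::finite family \<Rightarrow> nat \<Rightarrow> nat \<Rightarrow> real^'d \<Rightarrow> real^'d" where
  "BDF2 \<Delta>t u j n x = (1 / (2 * \<Delta>t)) *\<^sub>R (3 *\<^sub>R u j (n + 1) x - 4 *\<^sub>R u j n x + u j (n - 1) x)"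

text \<open>
  One of the two equations of a time step: \<open>a\<close> is the unknown, \<open>b\<close> the other (lagged) variable. The
  second equation is the first with \<open>v\<close> and \<open>w\<close> interchanged. The duality pairing of \<open>f j t\<close>
  with a test function is application.
\<close>

definition step_eq ::
    "(real^'d) set \<Rightarrow> (real^'d \<Rightarrow> real^'d) set \<Rightarrow> nat \<Rightarrow> real \<Rightarrow> real \<Rightarrow> real \<Rightarrow>
     (nat \<Rightarrow> real \<Rightarrow> (real^'d \<Rightarrow> real^'d) \<Rightarrow> real) \<Rightarrow> 'd::finite family \<Rightarrow> 'd family \<Rightarrow> nat \<Rightarrow> nat \<Rightarrow> bool" where
  "step_eq \<Omega> Vh J \<Delta>t \<nu> \<nu>\<^sub>m f a b j n \<longleftrightarrow> (\<forall>\<phi>\<in>Vh.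
      ip \<Omega> (BDF2 \<Delta>t a j n) \<phi>
      + (\<nu> + \<nu>\<^sub>m) / 2 * ip \<Omega> (grad \<Omega> (a j (n + 1))) (grad \<Omega> \<phi>)
      + (\<nu> - \<nu>\<^sub>m) / 2 * ip \<Omega> (grad \<Omega> (extrap b j n)) (grad \<Omega> \<phi>)
      + ip \<Omega> (conv \<Omega> (ens_mean J b n) (a j (n + 1))) \<phi>
      + ip \<Omega> (conv \<Omega> (fluct J b j n) (extrap a j n)) \<phi>
      = f j (real (n + 1) * \<Delta>t) \<phi>)"

definition scheme_solution ::
    "(real^'d) set \<Rightarrow> (real^'d \<Rightarrow> real^'d) set \<Rightarrow> nat \<Rightarrow> nat \<Rightarrow> real \<Rightarrow> real \<Rightarrow> real \<Rightarrow>
     (nat \<Rightarrow> real \<Rightarrow> (real^'d \<Rightarrow> real^'d) \<Rightarrow> real) \<Rightarrow> (nat \<Rightarrow> real \<Rightarrow> (real^'d \<Rightarrow> real^'d) \<Rightarrow> real) \<Rightarrow>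
     'd::finite family \<Rightarrow> 'd family \<Rightarrow> bool" where
  "scheme_solution \<Omega> Vh J M \<Delta>t \<nu> \<nu>\<^sub>m f\<^sub>1 f\<^sub>2 v w \<longleftrightarrow>
     (\<forall>j\<in>{1..J}. v j 0 \<in> Vh \<and> v j 1 \<in> Vh \<and> w j 0 \<in> Vh \<and> w j 1 \<in> Vh) \<and>
     (\<forall>n\<in>{1..M-1}. \<forall>j\<in>{1..J}. v j (n + 1) \<in> Vh \<and> w j (n + 1) \<in> Vh \<and>
        step_eq \<Omega> Vh J \<Delta>t \<nu> \<nu>\<^sub>m f\<^sub>1 v w j n \<and> step_eq \<Omega> Vh J \<Delta>t \<nu> \<nu>\<^sub>m f\<^sub>2 w v j n)"

definition dt_denominator ::
    "(real^'d) set \<Rightarrow> nat \<Rightarrow> real \<Rightarrow> real \<Rightarrow> real \<Rightarrow> real \<Rightarrow> 'd::finite family \<Rightarrow> 'd family \<Rightarrow> nat \<Rightarrow> real" where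
  "dt_denominator \<Omega> J \<nu> \<nu>\<^sub>m Ci Cs v w n =
     3 * (\<nu> - \<nu>\<^sub>m)\<^sup>2 * Ci\<^sup>2 + 12 * Cs\<^sup>2 * Ci\<^sup>2 *
       Max (\<Union>j\<in>{1..J}. {(nrm \<Omega> (grad \<Omega> (fluct J v j n)))\<^sup>2, (nrm \<Omega> (grad \<Omega> (fluct J w j n)))\<^sup>2})"

end

theory Submission
  imports Defs
begin

text \<open>
  The proof is an energy argument: each of the two equations at level \<open>n\<close> is tested with its own
  unknown at level \<open>n + 1\<close>. The BDF2 difference then yields the increment of the energy plus the
  square of the second difference \<open>\<delta>u\<^sup>n = u\<^sup>n\<^sup>+\<^sup>1 - 2u\<^sup>n + u\<^sup>n\<^sup>-\<^sup>1\<close>, by \<open>bdf2_identity\<close>. These squares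
  are the numerical dissipation which pays for the lagged terms. Indeed \<open>2u\<^sup>n - u\<^sup>n\<^sup>-\<^sup>1\<close> is
  \<open>u\<^sup>n\<^sup>+\<^sup>1 - \<delta>u\<^sup>n\<close>, so in each lagged term the new value separates from a second difference:

  \<^item> in the viscous coupling, the part with new values is dominated by the implicit diffusion, and
    the viscosity that survives is \<open>\<alpha> / 2\<close>;
  \<^item> in the convective terms, the parts with new values vanish, because
    \<open>(u \<cdot> \<nabla>v, v) = 0\<close> for divergence-free \<open>u\<close> (\<open>conv_skew\<close>).

  The remaining terms are the two containing \<open>\<delta>v\<^sup>n\<close> or \<open>\<delta>w\<^sup>n\<close> and the forcing. Young's
  inequality charges \<open>\<alpha> / 12\<close> of the viscosity to each of these three, hence \<open>\<alpha> / 4\<close> is left for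
  the left-hand side (\<open>one_equation_energy\<close>, \<open>add_equation_energies\<close>). What Young's inequality
  leaves of the gradients of the second differences is turned into norms of the second differences
  by the inverse inequality, and the restriction on the time step says exactly that the numerical
  dissipation absorbs them (\<open>time_step_absorbs\<close>). Summation over \<open>n\<close> telescopes.

  The analytical work is in the skew symmetry. For test functions it is integration by parts;
  it extends to \<open>H\<^sub>0\<^sup>1\<close> by density, the trilinear estimate giving the continuity.
  Throughout, the gradient is only some representative of the weak gradient, so even its linearity
  holds almost everywhere and rests on the uniqueness of weak gradients. This is the fundamental
  lemma of the calculus of variations, for which smooth bump functions are constructed.
\<close>

section \<open>Square-integrable functions\<close>

lemma L2D:
  assumes "u \<in> L2 \<Omega>"
  shows "u \<in> borel_measurable (lebesgue_on \<Omega>)" "integrable (lebesgue_on \<Omega>) (\<lambda>x. (norm (u x))\<^sup>2)"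
  using assms by (auto simp: L2_def)

lemma L2_lincomb:
  assumes u: "u \<in> L2 \<Omega>" and v: "v \<in> L2 \<Omega>"
  shows "(\<lambda>x. a *\<^sub>R u x + b *\<^sub>R v x) \<in> L2 \<Omega>"
proof -
  have m: "(\<lambda>x. a *\<^sub>R u x + b *\<^sub>R v x) \<in> borel_measurable (lebesgue_on \<Omega>)"
    using L2D(1)[OF u] L2D(1)[OF v] by measurable
  have "integrable (lebesgue_on \<Omega>) (\<lambda>x. 2 * a\<^sup>2 * (norm (u x))\<^sup>2 + 2 * b\<^sup>2 * (norm (v x))\<^sup>2)"
    using L2D(2)[OF u] L2D(2)[OF v] by simp
  then have "integrable (lebesgue_on \<Omega>) (\<lambda>x. (norm (a *\<^sub>R u x + b *\<^sub>R v x))\<^sup>2)"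
  proof (rule Bochner_Integration.integrable_bound)
    show "(\<lambda>x. (norm (a *\<^sub>R u x + b *\<^sub>R v x))\<^sup>2) \<in> borel_measurable (lebesgue_on \<Omega>)"
      using m by measurable
    show "AE x in lebesgue_on \<Omega>. norm ((norm (a *\<^sub>R u x + b *\<^sub>R v x))\<^sup>2)
        \<le> norm (2 * a\<^sup>2 * (norm (u x))\<^sup>2 + 2 * b\<^sup>2 * (norm (v x))\<^sup>2)"
    proof (rule AE_I2)
      fix x
      have "norm (a *\<^sub>R u x + b *\<^sub>R v x) \<le> \<bar>a\<bar> * norm (u x) + \<bar>b\<bar> * norm (v x)"
        by (metis norm_triangle_ineq norm_scaleR)
      then have "(norm (a *\<^sub>R u x + b *\<^sub>R v x))\<^sup>2 \<le> (\<bar>a\<bar> * norm (u x) + \<bar>b\<bar> * norm (v x))\<^sup>2"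
        by (intro power_mono) auto
      also have "\<dots> \<le> 2 * (\<bar>a\<bar> * norm (u x))\<^sup>2 + 2 * (\<bar>b\<bar> * norm (v x))\<^sup>2"
        using sum_squares_bound[of "\<bar>a\<bar> * norm (u x)" "\<bar>b\<bar> * norm (v x)"]
        by (simp add: power2_sum)
      finally show "norm ((norm (a *\<^sub>R u x + b *\<^sub>R v x))\<^sup>2)
          \<le> norm (2 * a\<^sup>2 * (norm (u x))\<^sup>2 + 2 * b\<^sup>2 * (norm (v x))\<^sup>2)"
        by (simp add: power_mult_distrib)
    qed
  qed
  with m show ?thesis by (simp add: L2_def)
qed

lemma L2_zero: "(\<lambda>x. 0) \<in> L2 \<Omega>"
  by (simp add: L2_def)

lemma L2_scale: "u \<in> L2 \<Omega> \<Longrightarrow> (\<lambda>x. a *\<^sub>R u x) \<in> L2 \<Omega>"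
  using L2_lincomb[of u \<Omega> u a 0] by simp

lemma L2_add: "u \<in> L2 \<Omega> \<Longrightarrow> v \<in> L2 \<Omega> \<Longrightarrow> (\<lambda>x. u x + v x) \<in> L2 \<Omega>"
  using L2_lincomb[of u \<Omega> v 1 1] by simp

lemma L2_diff: "u \<in> L2 \<Omega> \<Longrightarrow> v \<in> L2 \<Omega> \<Longrightarrow> (\<lambda>x. u x - v x) \<in> L2 \<Omega>"
  using L2_lincomb[of u \<Omega> v 1 "-1"] by simp

lemma L2_sum: "(\<And>i. i \<in> I \<Longrightarrow> u i \<in> L2 \<Omega>) \<Longrightarrow> (\<lambda>x. \<Sum>i\<in>I. u i x) \<in> L2 \<Omega>"
  by (induction I rule: infinite_finite_induct) (auto intro: L2_zero L2_add)

lemma L2_bound: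
  assumes "v \<in> L2 \<Omega>" "u \<in> borel_measurable (lebesgue_on \<Omega>)"
    and "\<And>x. x \<in> \<Omega> \<Longrightarrow> norm (u x) \<le> C * norm (v x)"
  shows "u \<in> L2 \<Omega>"
proof -
  have "integrable (lebesgue_on \<Omega>) (\<lambda>x. (C *\<^sub>R norm (v x))\<^sup>2)"
    using L2D(2)[OF assms(1)] by (simp add: power_mult_distrib)
  then have "integrable (lebesgue_on \<Omega>) (\<lambda>x. (norm (u x))\<^sup>2)"
  proof (rule Bochner_Integration.integrable_bound)
    show "(\<lambda>x. (norm (u x))\<^sup>2) \<in> borel_measurable (lebesgue_on \<Omega>)"
      using assms(2) by measurable
    show "AE x in lebesgue_on \<Omega>. norm ((norm (u x))\<^sup>2) \<le> norm ((C *\<^sub>R norm (v x))\<^sup>2)"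
      using assms(3) by (intro AE_I2) (simp add: space_restrict_space power_mono)
  qed
  with assms(2) show ?thesis by (simp add: L2_def)
qed

lemma L2_product_integrable:
  assumes u: "u \<in> L2 \<Omega>" and v: "v \<in> L2 \<Omega>"
  shows "integrable (lebesgue_on \<Omega>) (\<lambda>x. u x \<bullet> v x)"
proof -
  have "integrable (lebesgue_on \<Omega>) (\<lambda>x. (norm (u x))\<^sup>2 + (norm (v x))\<^sup>2)"
    using L2D(2)[OF u] L2D(2)[OF v] by simp
  then show ?thesis
  proof (rule Bochner_Integration.integrable_bound)
    show "(\<lambda>x. u x \<bullet> v x) \<in> borel_measurable (lebesgue_on \<Omega>)"
      using L2D(1)[OF u] L2D(1)[OF v] by measurable
    show "AE x in lebesgue_on \<Omega>. norm (u x \<bullet> v x) \<le> norm ((norm (u x))\<^sup>2 + (norm (v x))\<^sup>2)"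
    proof (rule AE_I2)
      fix x
      have "\<bar>u x \<bullet> v x\<bar> \<le> norm (u x) * norm (v x)" by (rule Cauchy_Schwarz_ineq2)
      moreover have "2 * (norm (u x) * norm (v x)) \<le> (norm (u x))\<^sup>2 + (norm (v x))\<^sup>2"
        using sum_squares_bound[of "norm (u x)" "norm (v x)"] by simp
      moreover have "0 \<le> norm (u x) * norm (v x)" by simp
      ultimately show "norm (u x \<bullet> v x) \<le> norm ((norm (u x))\<^sup>2 + (norm (v x))\<^sup>2)"
        by simp
    qed
  qed
qed

lemma ip_commute: "ip \<Omega> u v = ip \<Omega> v u"
  by (simp add: ip_def inner_commute)

lemma ip_lincomb_left:
  assumes "u \<in> L2 \<Omega>" "v \<in> L2 \<Omega>" "w \<in> L2 \<Omega>"
  shows "ip \<Omega> (\<lambda>x. a *\<^sub>R u x + b *\<^sub>R v x) w = a * ip \<Omega> u w + b * ip \<Omega> v w"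
  using L2_product_integrable[OF assms(1,3)] L2_product_integrable[OF assms(2,3)]
  by (simp add: ip_def inner_add_left)

lemma ip_lincomb_right:
  assumes "u \<in> L2 \<Omega>" "v \<in> L2 \<Omega>" "w \<in> L2 \<Omega>"
  shows "ip \<Omega> w (\<lambda>x. a *\<^sub>R u x + b *\<^sub>R v x) = a * ip \<Omega> w u + b * ip \<Omega> w v"
  using ip_lincomb_left[OF assms] by (simp add: ip_commute)

lemma nrm_sq: "(nrm \<Omega> u)\<^sup>2 = ip \<Omega> u u"
  unfolding nrm_def ip_def by (simp add: power2_norm_eq_inner)

lemma nrm_nonneg: "0 \<le> nrm \<Omega> u"
  unfolding nrm_def by simp

lemma ip_self_nonneg: "0 \<le> ip \<Omega> u u"
  by (simp add: nrm_sq[symmetric])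

lemma ip_cong_AE:
  assumes "AE x in lebesgue_on \<Omega>. u x = u' x" "AE x in lebesgue_on \<Omega>. v x = v' x"
    and "u \<in> L2 \<Omega>" "v \<in> L2 \<Omega>" "u' \<in> L2 \<Omega>" "v' \<in> L2 \<Omega>"
  shows "ip \<Omega> u v = ip \<Omega> u' v'"
  unfolding ip_def
proof (rule integral_cong_AE)
  show "AE x in lebesgue_on \<Omega>. u x \<bullet> v x = u' x \<bullet> v' x"
    using assms(1,2) by eventually_elim simp
  show "(\<lambda>x. u x \<bullet> v x) \<in> borel_measurable (lebesgue_on \<Omega>)"
    by (rule borel_measurable_integrable[OF L2_product_integrable[OF assms(3,4)]])
  show "(\<lambda>x. u' x \<bullet> v' x) \<in> borel_measurable (lebesgue_on \<Omega>)"
    by (rule borel_measurable_integrable[OF L2_product_integrable[OF assms(5,6)]])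
qed

lemma nrm_cong_AE:
  assumes "AE x in lebesgue_on \<Omega>. u x = u' x" "u \<in> L2 \<Omega>" "u' \<in> L2 \<Omega>"
  shows "nrm \<Omega> u = nrm \<Omega> u'"
  using ip_cong_AE[OF assms(1,1,2,2,3,3)] by (metis nrm_nonneg nrm_sq power2_eq_imp_eq)

lemma nrm_zero: "nrm \<Omega> (\<lambda>x. 0) = 0"
  by (simp add: nrm_def)

lemma nrm_scale: "nrm \<Omega> (\<lambda>x. a *\<^sub>R u x) = \<bar>a\<bar> * nrm \<Omega> u"
  by (simp add: nrm_def power_mult_distrib real_sqrt_mult)

text \<open>
  A nonnegative quadratic form has a nonpositive discriminant. With the form \<open>\<parallel>a u + b v\<parallel>\<^sup>2\<close> this is
  the Cauchy-Schwarz inequality, which must be derived because functions equal almost everywhere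
  are not identified, so \<open>ip\<close> is only semidefinite.
\<close>

lemma discriminant_nonpos:
  fixes U I V :: real
  assumes q: "\<And>a b. 0 \<le> a\<^sup>2 * U + 2 * a * b * I + b\<^sup>2 * V" and "0 \<le> V"
  shows "I\<^sup>2 \<le> U * V"
proof (cases "V = 0")
  case True
  have "I = 0"
  proof (rule ccontr)
    assume n: "I \<noteq> 0"
    then have "2 * (- (U + 1) / (2 * I)) * I = - (U + 1)" by simp
    with q[of 1 "- (U + 1) / (2 * I)"] True show False by simp
  qed
  with True show ?thesis by simp
next
  case False
  have "0 \<le> V * (U * V - I\<^sup>2)"
    using q[of V "- I"] by (simp add: algebra_simps power2_eq_square)
  with False \<open>0 \<le> V\<close> show ?thesis
    using zero_le_mult_iff[of V "U * V - I\<^sup>2"] by auto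
qed

lemma ip_le_nrm_mult:
  assumes u: "u \<in> L2 \<Omega>" and v: "v \<in> L2 \<Omega>"
  shows "\<bar>ip \<Omega> u v\<bar> \<le> nrm \<Omega> u * nrm \<Omega> v"
proof -
  have q: "0 \<le> a\<^sup>2 * (nrm \<Omega> u)\<^sup>2 + 2 * a * b * ip \<Omega> u v + b\<^sup>2 * (nrm \<Omega> v)\<^sup>2" for a b
  proof -
    have "0 \<le> ip \<Omega> (\<lambda>x. a *\<^sub>R u x + b *\<^sub>R v x) (\<lambda>x. a *\<^sub>R u x + b *\<^sub>R v x)"
      by (rule ip_self_nonneg)
    also have "\<dots> = a * (a * ip \<Omega> u u + b * ip \<Omega> u v) + b * (a * ip \<Omega> v u + b * ip \<Omega> v v)"
      by (simp add: ip_lincomb_left ip_lincomb_right u v L2_lincomb)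
    also have "\<dots> = a\<^sup>2 * (nrm \<Omega> u)\<^sup>2 + 2 * a * b * ip \<Omega> u v + b\<^sup>2 * (nrm \<Omega> v)\<^sup>2"
      unfolding nrm_sq by (simp add: ip_commute[of \<Omega> v u] algebra_simps power2_eq_square)
    finally show ?thesis .
  qed
  have "(ip \<Omega> u v)\<^sup>2 \<le> (nrm \<Omega> u)\<^sup>2 * (nrm \<Omega> v)\<^sup>2"
    using discriminant_nonpos[of "(nrm \<Omega> u)\<^sup>2" "ip \<Omega> u v" "(nrm \<Omega> v)\<^sup>2"] q by simp
  then have "(ip \<Omega> u v)\<^sup>2 \<le> (nrm \<Omega> u * nrm \<Omega> v)\<^sup>2"
    by (simp add: power_mult_distrib)
  then have "\<bar>ip \<Omega> u v\<bar> \<le> \<bar>nrm \<Omega> u * nrm \<Omega> v\<bar>"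
    by (simp only: abs_le_square_iff)
  then show ?thesis by (simp add: nrm_nonneg abs_mult)
qed

lemma nrm_add_le:
  assumes u: "u \<in> L2 \<Omega>" and v: "v \<in> L2 \<Omega>"
  shows "nrm \<Omega> (\<lambda>x. u x + v x) \<le> nrm \<Omega> u + nrm \<Omega> v"
proof (rule power2_le_imp_le)
  have "(nrm \<Omega> (\<lambda>x. u x + v x))\<^sup>2 = (nrm \<Omega> u)\<^sup>2 + 2 * ip \<Omega> u v + (nrm \<Omega> v)\<^sup>2"
    using ip_lincomb_left[OF u v L2_add[OF u v], of 1 1]
      ip_lincomb_right[OF u v u, of 1 1] ip_lincomb_right[OF u v v, of 1 1]
    by (simp add: nrm_sq ip_commute[of \<Omega> v u])
  also have "\<dots> \<le> (nrm \<Omega> u + nrm \<Omega> v)\<^sup>2"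
    using ip_le_nrm_mult[OF u v] by (simp add: power2_sum)
  finally show "(nrm \<Omega> (\<lambda>x. u x + v x))\<^sup>2 \<le> (nrm \<Omega> u + nrm \<Omega> v)\<^sup>2" .
qed (simp add: nrm_nonneg)

lemma L2_component:
  fixes u :: "real^'d \<Rightarrow> real^'m"
  assumes "u \<in> L2 \<Omega>"
  shows "(\<lambda>x. u x $ i) \<in> L2 \<Omega>"
proof (rule L2_bound[OF assms])
  have "(\<lambda>y::real^'m. y $ i) \<in> borel_measurable borel"
    by (rule borel_measurable_continuous_onI[OF linear_continuous_on[OF bounded_linear_vec_nth]])
  from measurable_compose[OF L2D(1)[OF assms] this]
  show "(\<lambda>x. u x $ i) \<in> borel_measurable (lebesgue_on \<Omega>)" .
  show "norm (u x $ i) \<le> 1 * norm (u x)" for x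
    using component_le_norm_cart[of "u x" i] by simp
qed

lemma measurable_vec_lambda:
  fixes f :: "'m::finite \<Rightarrow> 'a \<Rightarrow> 'b::euclidean_space"
  assumes "\<And>i. f i \<in> borel_measurable M"
  shows "(\<lambda>x. \<chi> i. f i x) \<in> borel_measurable M"
proof -
  have "(\<lambda>x. (\<chi> i. f i x) \<bullet> b) \<in> borel_measurable M" if "b \<in> Basis" for b :: "'b^'m"
  proof -
    from that obtain i e where "b = axis i e" "e \<in> Basis" by (auto simp: Basis_vec_def)
    then show ?thesis using assms[of i] by (simp add: inner_axis)
  qed
  then show ?thesis by (simp add: borel_measurable_euclidean_space[where f="\<lambda>x. \<chi> i. f i x"])
qed

lemma L2_vec_lambda:
  fixes u :: "'m::finite \<Rightarrow> real^'d \<Rightarrow> 'b::euclidean_space"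
  assumes "\<And>i. u i \<in> L2 \<Omega>"
  shows "(\<lambda>x. \<chi> i. u i x) \<in> L2 \<Omega>"
proof -
  have "integrable (lebesgue_on \<Omega>) (\<lambda>x. \<Sum>i\<in>UNIV. (norm (u i x))\<^sup>2)"
    using L2D(2)[OF assms] by auto
  moreover have "(norm (\<chi> i. u i x))\<^sup>2 = (\<Sum>i\<in>UNIV. (norm (u i x))\<^sup>2)" for x
    by (simp add: norm_vec_def L2_set_def sum_nonneg)
  ultimately show ?thesis
    using measurable_vec_lambda[of u] L2D(1)[OF assms] by (simp add: L2_def)
qed

lemma ip_vec:
  fixes u v :: "real^'d \<Rightarrow> ('b::euclidean_space)^'m"
  assumes "\<And>i. (\<lambda>x. u x $ i) \<in> L2 \<Omega>" "\<And>i. (\<lambda>x. v x $ i) \<in> L2 \<Omega>"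
  shows "ip \<Omega> u v = (\<Sum>i\<in>UNIV. ip \<Omega> (\<lambda>x. u x $ i) (\<lambda>x. v x $ i))"
  unfolding ip_def inner_vec_def
  by (rule Bochner_Integration.integral_sum) (rule L2_product_integrable[OF assms])

section \<open>Smooth functions and bump functions\<close>

lemma partial_eq:
  assumes "(\<phi> has_derivative D) (at x)"
  shows "partial i \<phi> x = D (axis i 1)"
  using frechet_derivative_at[OF assms] by (simp add: partial_def)

text \<open>
  Smoothness is derived from an explicit formula for the derivative, since the recursion of
  \<open>C_k\<close> goes through the chosen \<open>frechet_derivative\<close>.
\<close>

lemma C_k_SucI:
  assumes "\<And>x. (\<phi> has_derivative D x) (at x)" "\<And>i. C_k k (\<lambda>x. D x (axis i 1))"
  shows "C_k (Suc k) \<phi>"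
proof -
  have "partial i \<phi> = (\<lambda>x. D x (axis i 1))" for i
    using partial_eq[OF assms(1)] by auto
  then show ?thesis using assms by (auto simp: differentiable_def)
qed

lemma C_k_differentiable: "C_k (Suc k) \<phi> \<Longrightarrow> \<phi> differentiable (at x)"
  by simp

lemma C_k_partial: "C_k (Suc k) \<phi> \<Longrightarrow> C_k k (partial i \<phi>)"
  by simp

lemma C_k_Suc_imp: "C_k (Suc k) \<phi> \<Longrightarrow> C_k k \<phi>"
proof (induction k arbitrary: \<phi>)
  case 0
  then have "\<phi> differentiable_on UNIV" by (auto simp: differentiable_on_def)
  then show ?case by (auto intro: differentiable_imp_continuous_on)
next
  case (Suc k)
  have "C_k k (partial i \<phi>)" for i
    using Suc.prems by (intro Suc.IH) (rule C_k_partial)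
  with C_k_differentiable[OF Suc.prems] show ?case by simp
qed

lemma C_k_const: "C_k k (\<lambda>x. c)"
proof (induction k arbitrary: c)
  case (Suc k)
  show ?case by (rule C_k_SucI[where D="\<lambda>x h. 0"]) (auto intro: Suc)
qed simp

lemma has_derivative_partial:
  assumes "\<phi> differentiable (at x)"
  shows "(\<phi> has_derivative frechet_derivative \<phi> (at x)) (at x)"
  using assms frechet_derivative_works by blast

lemma partial_add:
  assumes "f differentiable (at x)" "g differentiable (at x)"
  shows "partial i (\<lambda>x. f x + g x) x = partial i f x + partial i g x"
  using partial_eq[OF has_derivative_add[OF assms[THEN has_derivative_partial]]]
  by (simp add: partial_def)

lemma partial_mult:
  assumes "f differentiable (at x)" "g differentiable (at x)"
  shows "partial i (\<lambda>x. f x * g x) x = f x * partial i g x + partial i f x * g x"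
  using partial_eq[OF has_derivative_mult[OF assms[THEN has_derivative_partial]]]
  by (simp add: partial_def)

lemma C_k_add: "C_k k f \<Longrightarrow> C_k k g \<Longrightarrow> C_k k (\<lambda>x. f x + g x)"
proof (induction k arbitrary: f g)
  case 0
  then show ?case by (auto intro: continuous_on_add)
next
  case (Suc k)
  have "partial i (\<lambda>x. f x + g x) = (\<lambda>x. partial i f x + partial i g x)" for i
    using Suc.prems by (auto simp: partial_add)
  with Suc show ?case by (auto intro: differentiable_add)
qed

lemma C_k_mult: "C_k k f \<Longrightarrow> C_k k g \<Longrightarrow> C_k k (\<lambda>x. f x * g x)"
proof (induction k arbitrary: f g)
  case 0
  then show ?case by (auto intro: continuous_on_mult)
next
  case (Suc k)
  have "partial i (\<lambda>x. f x * g x) = (\<lambda>x. f x * partial i g x + partial i f x * g x)" for i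
    using Suc.prems by (auto simp: partial_mult)
  moreover have "C_k k (\<lambda>x. f x * partial i g x + partial i f x * g x)" for i
    using Suc.prems Suc.prems[THEN C_k_Suc_imp] by (intro C_k_add Suc.IH) auto
  ultimately show ?case using Suc.prems by (auto intro: differentiable_mult)
qed

lemma C_k_prod:
  assumes "\<And>i. i \<in> I \<Longrightarrow> C_k k (f i)"
  shows "C_k k (\<lambda>x. \<Prod>i\<in>I. f i x)"
  using assms by (induction I rule: infinite_finite_induct) (auto intro: C_k_const C_k_mult)

text \<open>
  The functions \<open>t \<mapsto> P(1/t) exp(-1/t)\<close>, extended by zero to \<open>t \<le> 0\<close>. Keeping a polynomial factor
  makes the family closed under differentiation, so a single derivative computation shows all of
  its members to be smooth; the classical flat function is the one for \<open>P = 1\<close>.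
\<close>

definition flat :: "real poly \<Rightarrow> real \<Rightarrow> real" where
  "flat p t = (if t \<le> 0 then 0 else poly p (1 / t) * exp (- (1 / t)))"

lemma poly_times_exp_minus_tendsto_0: "((\<lambda>y. poly p y * exp (- y)) \<longlongrightarrow> (0::real)) at_top"
proof -
  have "((\<lambda>y. \<Sum>i\<le>degree p. coeff p i * (y ^ i / exp y)) \<longlongrightarrow> (\<Sum>i\<le>degree p. coeff p i * 0)) at_top"
    by (intro tendsto_intros tendsto_power_div_exp_0)
  then show ?thesis
    by (simp add: poly_altdef exp_minus sum_distrib_right divide_inverse mult.assoc)
qed

text \<open>
  At the origin the difference quotient from the right is again of the form \<open>P(1/t) exp(-1/t)\<close>, and
  it tends to zero because the exponential beats the polynomial.
\<close>

lemma flat_has_derivative: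
  "(flat p has_real_derivative flat ([:0, 0, 1:] * (p - pderiv p)) t) (at t)"
proof (cases t "0::real" rule: linorder_cases)
  case less
  have "((\<lambda>t. 0) has_real_derivative 0) (at t)" by simp
  then have "(flat p has_real_derivative 0) (at t)"
    by (rule has_field_derivative_transform_within_open[where S="{..<0}"])
      (use less in \<open>auto simp: flat_def\<close>)
  with less show ?thesis by (simp add: flat_def)
next
  case greater
  have "((\<lambda>t. poly p (1 / t) * exp (- (1 / t))) has_real_derivative
      poly (pderiv p) (1 / t) * (- 1 / t\<^sup>2) * exp (- (1 / t))
      + poly p (1 / t) * (exp (- (1 / t)) * (1 / t\<^sup>2))) (at t)"
    using greater
    by (auto intro!: derivative_eq_intros DERIV_chain2[OF poly_DERIV] simp: power2_eq_square)
  then have "(flat p has_real_derivative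
      poly (pderiv p) (1 / t) * (- 1 / t\<^sup>2) * exp (- (1 / t))
      + poly p (1 / t) * (exp (- (1 / t)) * (1 / t\<^sup>2))) (at t)"
    by (rule has_field_derivative_transform_within_open[where S="{0<..}"])
      (use greater in \<open>auto simp: flat_def\<close>)
  moreover have "poly (pderiv p) (1 / t) * (- 1 / t\<^sup>2) * exp (- (1 / t))
      + poly p (1 / t) * (exp (- (1 / t)) * (1 / t\<^sup>2)) = flat ([:0, 0, 1:] * (p - pderiv p)) t"
    using greater by (simp add: flat_def field_simps power2_eq_square)
  ultimately show ?thesis by simp
next
  case equal
  have "((\<lambda>h. flat p h / h) \<longlongrightarrow> 0) (at_left 0)"
    by (rule tendsto_eventually) (auto simp: flat_def eventually_at_filter)
  moreover have "((\<lambda>h. flat p h / h) \<longlongrightarrow> 0) (at_right 0)"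
  proof -
    have "((\<lambda>h. poly (pCons 0 p) (inverse h) * exp (- (inverse h))) \<longlongrightarrow> 0) (at_right (0::real))"
      by (rule filterlim_compose[OF poly_times_exp_minus_tendsto_0 filterlim_inverse_at_top_right])
    then show ?thesis
      by (rule Lim_transform_eventually)
        (auto simp: flat_def eventually_at_filter divide_inverse intro!: always_eventually)
  qed
  ultimately have "((\<lambda>h. flat p h / h) \<longlongrightarrow> 0) (at 0)"
    by (simp add: filterlim_split_at)
  then show ?thesis using equal by (simp add: DERIV_def flat_def)
qed

lemma flat_affine_has_derivative:
  "((\<lambda>x. flat p (c * x $ i + d)) has_derivative
    (\<lambda>h. (c * h $ i) * flat ([:0, 0, 1:] * (p - pderiv p)) (c * x $ i + d))) (at x)"
proof -
  have "((\<lambda>x. c * x $ i + d) has_derivative (\<lambda>h. c * h $ i)) (at x)"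
    by (auto intro!: derivative_eq_intros bounded_linear.has_derivative[OF bounded_linear_vec_nth])
  from DERIV_compose_FDERIV[OF flat_has_derivative this] show ?thesis by simp
qed

lemma C_k_flat_affine: "C_k k (\<lambda>x. flat p (c * x $ i + d))"
proof (induction k arbitrary: p)
  case 0
  have "(\<lambda>x. flat p (c * x $ i + d)) differentiable_on UNIV"
    unfolding differentiable_on_def differentiable_def using flat_affine_has_derivative by blast
  then show ?case by (auto intro: differentiable_imp_continuous_on)
next
  case (Suc k)
  show ?case
    by (rule C_k_SucI[OF flat_affine_has_derivative]) (intro C_k_mult C_k_const Suc)
qed

text \<open>
  Smooth and positive exactly on the open box (for \<open>n > 0\<close>). The dilation by \<open>n\<close> steepens the slopes,
  since \<open>exp(-1/(n t)) \<rightarrow> 1\<close> for \<open>t > 0\<close>: as \<open>n\<close> grows, the bumps approach the indicator function of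
  the box. The arguments are written as affine functions of a coordinate in order to match
  \<open>C_k_flat_affine\<close>.
\<close>

definition box_bump :: "real^'d \<Rightarrow> real^'d \<Rightarrow> nat \<Rightarrow> real^'d \<Rightarrow> real" where
  "box_bump a b n x =
     (\<Prod>i\<in>UNIV. flat 1 (real n * x $ i + - real n * a $ i) * flat 1 (- real n * x $ i + real n * b $ i))"

lemma box_bump_eq_0: "x \<notin> box a b \<Longrightarrow> box_bump a b n x = 0"
proof -
  assume "x \<notin> box a b"
  then obtain i where "x $ i \<le> a $ i \<or> b $ i \<le> x $ i"
    by (auto simp: mem_box_cart not_less)
  then have "real n * x $ i + - real n * a $ i \<le> 0 \<or> - real n * x $ i + real n * b $ i \<le> 0"
    by (auto intro: mult_left_mono)
  then show ?thesis unfolding box_bump_def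
    by (intro prod_zero) (auto simp: flat_def intro!: exI[of _ i])
qed

lemma box_bump_test_fun:
  assumes "cbox a b \<subseteq> \<Omega>"
  shows "box_bump a b n \<in> test_fun \<Omega>"
proof -
  have "{x. box_bump a b n x \<noteq> 0} \<subseteq> cbox a b"
    using box_bump_eq_0 box_subset_cbox by fast
  then have "closure {x. box_bump a b n x \<noteq> 0} \<subseteq> cbox a b"
    by (rule closure_minimal) (rule closed_cbox)
  moreover from this have "compact (closure {x. box_bump a b n x \<noteq> 0})"
    by (meson bounded_cbox bounded_subset closed_closure compact_eq_bounded_closed)
  moreover have "C_k k (box_bump a b n)" for k
    unfolding box_bump_def by (intro C_k_prod C_k_mult C_k_flat_affine)
  ultimately show ?thesis using assms unfolding test_fun_def by auto
qed

lemma flat_1_bounds: "0 \<le> flat 1 t" "flat 1 t \<le> 1"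
  by (auto simp: flat_def)

lemma box_bump_bounds: "0 \<le> box_bump a b n x" "box_bump a b n x \<le> 1"
  unfolding box_bump_def
  by (auto intro!: prod_nonneg prod_le_1 mult_le_one mult_nonneg_nonneg flat_1_bounds)

lemma flat_1_tendsto:
  assumes "0 < t"
  shows "(\<lambda>n. flat 1 (real n * t)) \<longlonglongrightarrow> 1"
proof -
  have "(\<lambda>n. exp (- (1 / t * inverse (real n)))) \<longlonglongrightarrow> exp (- (1 / t * 0))"
    by (intro tendsto_intros lim_inverse_n)
  moreover have "\<forall>\<^sub>F n in sequentially. exp (- (1 / t * inverse (real n))) = flat 1 (real n * t)"
    using eventually_gt_at_top[of 0]
    by eventually_elim (use assms in \<open>auto simp: flat_def not_le divide_simps mult_le_0_iff\<close>)
  ultimately show ?thesis by (auto intro: Lim_transform_eventually)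
qed

lemma box_bump_tendsto: "(\<lambda>n. box_bump a b n x) \<longlonglongrightarrow> indicator (box a b) x"
proof (cases "x \<in> box a b")
  case True
  then have "(\<lambda>n. flat 1 (real n * (x $ i - a $ i)) * flat 1 (real n * (b $ i - x $ i))) \<longlonglongrightarrow> 1 * 1" for i
    by (intro tendsto_mult flat_1_tendsto) (auto simp: mem_box_cart)
  then have "(\<lambda>n. \<Prod>i\<in>UNIV. flat 1 (real n * (x $ i - a $ i)) * flat 1 (real n * (b $ i - x $ i)))
      \<longlonglongrightarrow> (\<Prod>i\<in>(UNIV::'a set). 1 * 1)"
    by (intro tendsto_prod) auto
  then show ?thesis using True by (simp add: box_bump_def algebra_simps)
qed (simp add: box_bump_eq_0)

section \<open>The fundamental lemma of the calculus of variations\<close>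

text \<open>
  Dominated convergence along the bumps, which stay between 0 and 1.
\<close>

lemma orthogonal_test_fun_box_integral_0:
  fixes g :: "real^'d \<Rightarrow> real"
  assumes g: "integrable (lebesgue_on \<Omega>) g"
    and orth: "\<And>\<phi>. \<phi> \<in> test_fun \<Omega> \<Longrightarrow> (LINT x|lebesgue_on \<Omega>. g x * \<phi> x) = 0"
    and sub: "cbox a b \<subseteq> \<Omega>" and \<Omega>: "\<Omega> \<in> sets lebesgue"
  shows "(LINT x|lebesgue_on \<Omega>. g x * indicator (box a b) x) = 0"
proof -
  have [measurable]: "g \<in> borel_measurable (lebesgue_on \<Omega>)" using g by auto
  have [measurable]: "box a b \<in> sets (lebesgue_on \<Omega>)"
    using sub box_subset_cbox[of a b] \<Omega> by (subst sets_restrict_space_iff) auto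
  have bm [measurable]: "box_bump a b n \<in> borel_measurable (lebesgue_on \<Omega>)" for n
  proof -
    have "continuous_on UNIV (box_bump a b n)"
      using box_bump_test_fun[OF sub, of n] C_k.simps(1)[of "box_bump a b n"]
      unfolding test_fun_def by blast
    then have "box_bump a b n \<in> borel_measurable borel"
      by (rule borel_measurable_continuous_onI)
    then show ?thesis
      by (simp add: measurable_completion measurable_restrict_space1)
  qed
  have "(\<lambda>n. LINT x|lebesgue_on \<Omega>. g x * box_bump a b n x)
      \<longlonglongrightarrow> (LINT x|lebesgue_on \<Omega>. g x * indicator (box a b) x)"
  proof (rule integral_dominated_convergence[where w="\<lambda>x. \<bar>g x\<bar>"])
    show "AE x in lebesgue_on \<Omega>. (\<lambda>n. g x * box_bump a b n x) \<longlonglongrightarrow> g x * indicator (box a b) x"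
      by (intro AE_I2 tendsto_intros box_bump_tendsto)
    show "AE x in lebesgue_on \<Omega>. norm (g x * box_bump a b n x) \<le> \<bar>g x\<bar>" for n
      using box_bump_bounds[of a b n]
      by (intro AE_I2) (simp add: abs_mult mult_left_le)
  qed (use g in auto)
  moreover have "(LINT x|lebesgue_on \<Omega>. g x * box_bump a b n x) = 0" for n
    by (rule orth) (rule box_bump_test_fun[OF sub])
  ultimately show ?thesis by (simp add: LIMSEQ_const_iff)
qed

text \<open>
  The integral of \<open>g\<close> over every closed box inside \<open>\<Omega>\<close> vanishes, and by Lebesgue differentiation
  \<open>g\<close> is almost everywhere the limit of its averages over boxes shrinking to a point.
\<close>

theorem fundamental_lemma_of_variations:
  fixes g :: "real^'d \<Rightarrow> real"
  assumes "open \<Omega>" and g: "integrable (lebesgue_on \<Omega>) g"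
    and orth: "\<And>\<phi>. \<phi> \<in> test_fun \<Omega> \<Longrightarrow> (LINT x|lebesgue_on \<Omega>. g x * \<phi> x) = 0"
  shows "AE x in lebesgue_on \<Omega>. g x = 0"
proof -
  have \<Omega>: "\<Omega> \<in> sets lebesgue" using \<open>open \<Omega>\<close> by auto
  define f where "f x = (if x \<in> \<Omega> then g x else 0)" for x
  have f: "integrable lebesgue f"
  proof -
    have "integrable lebesgue (\<lambda>x. indicator \<Omega> x *\<^sub>R g x)"
      using g \<Omega> by (subst (asm) integrable_restrict_space) auto
    moreover have "f = (\<lambda>x. indicator \<Omega> x *\<^sub>R g x)"
      by (auto simp: f_def)
    ultimately show ?thesis by simp
  qed
  have fi: "f integrable_on cbox a b" for a b
    by (rule integrable_on_subcbox[OF integrable_on_lebesgue[OF f]]) simp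
  obtain N where N: "negligible N"
    "\<And>x e. \<lbrakk>x \<notin> N; 0 < e\<rbrakk> \<Longrightarrow> \<exists>d>0. \<forall>h. 0 < h \<and> h < d \<longrightarrow>
        norm (integral (cbox x (x + h *\<^sub>R One)) f /\<^sub>R h ^ DIM(real^'d) - f x) < e"
    using integrable_ccontinuous_explicit[OF fi] by blast
  have zero: "integral (cbox a b) f = 0" if sub: "cbox a b \<subseteq> \<Omega>" for a b
  proof -
    have "(LINT x|lebesgue_on \<Omega>. g x * indicator (box a b) x) = 0"
      by (rule orthogonal_test_fun_box_integral_0[OF g orth sub \<Omega>])
    also have "(LINT x|lebesgue_on \<Omega>. g x * indicator (box a b) x)
        = (LINT x|lebesgue. f x * indicator (box a b) x)"
      using \<Omega> by (subst integral_restrict_space)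
        (auto simp: f_def indicator_def intro!: Bochner_Integration.integral_cong)
    also have "\<dots> = (LINT x|lebesgue. indicator (box a b) x *\<^sub>R f x)"
      by (simp add: mult.commute)
    also have "\<dots> = integral (box a b) f"
      using set_lebesgue_integral_eq_integral(2)[of "box a b" f]
        set_integrable_subset[of lebesgue UNIV f "box a b"] f
      by (simp add: set_lebesgue_integral_def set_integrable_def)
    finally show ?thesis by (simp add: integral_open_interval)
  qed
  have "f x = 0" if xN: "x \<notin> N" and x\<Omega>: "x \<in> \<Omega>" for x
  proof (rule ccontr)
    assume "f x \<noteq> 0"
    then obtain d where d: "d > 0" "\<And>h. 0 < h \<Longrightarrow> h < d \<Longrightarrow>
        norm (integral (cbox x (x + h *\<^sub>R One)) f /\<^sub>R h ^ DIM(real^'d) - f x) < \<bar>f x\<bar>"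
      using N(2)[OF xN, of "\<bar>f x\<bar>"] by auto
    obtain e where e: "e > 0" "ball x e \<subseteq> \<Omega>"
      using \<open>open \<Omega>\<close> x\<Omega> by (meson openE)
    \<comment> \<open>the box with corner \<open>x\<close> and side \<open>h\<close> has diameter \<open>h * norm One\<close>; the \<open>1\<close> only makes \<open>c\<close> positive\<close>
    define c where "c = norm (One :: real^'d) + 1"
    define h where "h = min (d / 2) (e / (2 * c))"
    have c: "c > 0" "norm (One :: real^'d) \<le> c" by (auto simp: c_def add_nonneg_pos)
    have h: "0 < h" "h < d" "h * c < e" 
      using d(1) e(1) c(1) by (auto simp: h_def min_def field_simps)
    have "cbox x (x + h *\<^sub>R One) \<subseteq> ball x e"
    proof
      fix y assume y: "y \<in> cbox x (x + h *\<^sub>R One)"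
      have "norm (y - x) \<le> norm (h *\<^sub>R (One :: real^'d))"
        using y h(1) by (intro norm_le_componentwise) (auto simp: mem_box inner_simps abs_if)
      also have "\<dots> \<le> h * c" using c(2) h(1) by (simp add: mult_left_mono)
      finally show "y \<in> ball x e" using h(3) by (simp add: dist_norm norm_minus_commute)
    qed
    with e have "integral (cbox x (x + h *\<^sub>R One)) f = 0" by (intro zero) auto
    with d(2)[OF h(1,2)] show False by simp
  qed
  then have "{x \<in> \<Omega>. g x \<noteq> 0} \<subseteq> N" by (auto simp: f_def)
  moreover have "N \<in> null_sets lebesgue" using N(1) negligible_iff_null_sets by blast
  ultimately have "AE x in lebesgue. x \<in> \<Omega> \<longrightarrow> g x = 0"
    by (intro AE_I'[of N]) auto
  then show ?thesis using \<Omega> by (simp add: AE_restrict_space_iff)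
qed

section \<open>Integration by parts for test functions\<close>

lemma test_fun_continuous:
  "\<phi> \<in> test_fun \<Omega> \<Longrightarrow> continuous_on UNIV \<phi>"
  using C_k.simps(1)[of \<phi>] unfolding test_fun_def mem_Collect_eq by blast

lemma test_fun_differentiable:
  assumes "\<phi> \<in> test_fun \<Omega>" shows "\<phi> differentiable (at x)"
proof (rule C_k_differentiable)
  show "C_k (Suc 0) \<phi>" using assms unfolding test_fun_def by blast
qed

lemma test_fun_partial_continuous:
  assumes "\<phi> \<in> test_fun \<Omega>" shows "continuous_on UNIV (partial i \<phi>)"
proof -
  have "C_k (Suc 0) \<phi>" using assms unfolding test_fun_def by blast
  from C_k_partial[OF this] show ?thesis by simp
qed

definition support :: "(real^'d \<Rightarrow> real) \<Rightarrow> (real^'d) set" where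
  "support \<phi> = closure {x. \<phi> x \<noteq> 0}"

lemma test_fun_support:
  assumes "\<phi> \<in> test_fun \<Omega>" shows "compact (support \<phi>)" "support \<phi> \<subseteq> \<Omega>"
  using assms unfolding test_fun_def support_def by blast+

lemma not_in_support: "x \<notin> support \<phi> \<Longrightarrow> \<phi> x = 0"
  unfolding support_def using closure_subset[of "{x. \<phi> x \<noteq> 0}"] by blast

lemma partial_not_in_support:
  assumes "x \<notin> support \<phi>" shows "partial i \<phi> x = 0"
proof -
  have "open (- support \<phi>)" unfolding support_def by (intro open_Compl closed_closure)
  then have "(\<phi> has_derivative (\<lambda>h. 0)) (at x)"
    using has_derivative_transform_within_open[of "\<lambda>x. 0" "\<lambda>h. 0" x UNIV "- support \<phi>" \<phi>]
      assms not_in_support[of _ \<phi>] by simp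
  from partial_eq[OF this] show ?thesis by simp
qed

lemma test_funI:
  assumes "\<And>k. C_k k \<phi>" "{x. \<phi> x \<noteq> 0} \<subseteq> K" "compact K" "K \<subseteq> \<Omega>"
  shows "\<phi> \<in> test_fun \<Omega>"
proof -
  have sub: "closure {x. \<phi> x \<noteq> 0} \<subseteq> K"
    by (rule closure_minimal[OF assms(2) compact_imp_closed[OF assms(3)]])
  then have "bounded (closure {x. \<phi> x \<noteq> 0})"
    by (rule bounded_subset[OF compact_imp_bounded[OF assms(3)]])
  then have "compact (closure {x. \<phi> x \<noteq> 0})"
    unfolding compact_eq_bounded_closed by simp
  with sub show ?thesis using assms(1,4) unfolding test_fun_def by blast
qed

lemma test_fun_C_k: "\<phi> \<in> test_fun \<Omega> \<Longrightarrow> C_k k \<phi>"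
  by (simp add: test_fun_def)

lemma test_fun_mult:
  assumes "\<phi> \<in> test_fun \<Omega>" "\<psi> \<in> test_fun \<Omega>"
  shows "(\<lambda>x. \<phi> x * \<psi> x) \<in> test_fun \<Omega>"
proof (rule test_funI)
  show "{x. \<phi> x * \<psi> x \<noteq> 0} \<subseteq> support \<phi>" using not_in_support[of _ \<phi>] by fastforce
  show "C_k k (\<lambda>x. \<phi> x * \<psi> x)" for k
    by (intro C_k_mult test_fun_C_k[OF assms(1)] test_fun_C_k[OF assms(2)])
qed (rule test_fun_support[OF assms(1)])+

lemma test_fun_lincomb:
  assumes "\<phi> \<in> test_fun \<Omega>" "\<psi> \<in> test_fun \<Omega>"
  shows "(\<lambda>x. a * \<phi> x + b * \<psi> x) \<in> test_fun \<Omega>"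
proof (rule test_funI)
  show "{x. a * \<phi> x + b * \<psi> x \<noteq> 0} \<subseteq> support \<phi> \<union> support \<psi>"
    using not_in_support[of _ \<phi>] not_in_support[of _ \<psi>] by fastforce
  show "C_k k (\<lambda>x. a * \<phi> x + b * \<psi> x)" for k
    by (intro C_k_add C_k_mult C_k_const test_fun_C_k[OF assms(1)] test_fun_C_k[OF assms(2)])
qed (use test_fun_support[OF assms(1)] test_fun_support[OF assms(2)] in \<open>auto simp: compact_Un\<close>)

lemma continuous_compact_support_bounded:
  fixes f :: "real^'d \<Rightarrow> real"
  assumes "continuous_on UNIV f" "compact K" "\<And>x. x \<notin> K \<Longrightarrow> f x = 0"
  obtains C where "0 \<le> C" "\<And>x. \<bar>f x\<bar> \<le> C"
proof -
  have "bounded (f ` K)"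
    by (rule compact_imp_bounded[OF compact_continuous_image[OF continuous_on_subset[OF assms(1)] assms(2)]]) simp
  then obtain C where "\<And>x. x \<in> K \<Longrightarrow> \<bar>f x\<bar> \<le> C" by (auto simp: bounded_iff)
  then have "\<bar>f x\<bar> \<le> max C 0" for x
    using assms(3)[of x] \<open>\<And>x. x \<in> K \<Longrightarrow> \<bar>f x\<bar> \<le> C\<close>[of x] by (cases "x \<in> K") (auto simp: le_max_iff_disj)
  then show ?thesis by (intro that[of "max C 0"]) auto
qed

lemma continuous_compact_support_integrable:
  fixes f :: "real^'d \<Rightarrow> real"
  assumes "continuous_on UNIV f" "compact K" "\<And>x. x \<notin> K \<Longrightarrow> f x = 0"
  shows "integrable lborel f"
proof -
  have "integrable lborel (\<lambda>x. indicator K x *\<^sub>R f x)"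
    using assms(1,2) by (intro borel_integrable_compact) (auto intro: continuous_on_subset)
  moreover have "(\<lambda>x. indicator K x *\<^sub>R f x) = f"
    using assms(3) by (auto simp: fun_eq_iff indicator_def)
  ultimately show ?thesis by simp
qed

lemma lebesgue_on_integral_eq_lborel:
  fixes f :: "real^'d \<Rightarrow> real"
  assumes "\<Omega> \<in> sets lebesgue" "f \<in> borel_measurable borel" "\<And>x. x \<notin> \<Omega> \<Longrightarrow> f x = 0"
  shows "(LINT x|lebesgue_on \<Omega>. f x) = (LINT x|lborel. f x)"
proof -
  have "(LINT x|lebesgue_on \<Omega>. f x) = (LINT x|lebesgue. indicator \<Omega> x *\<^sub>R f x)"
    using assms(1) by (simp add: integral_restrict_space)
  also have "(\<lambda>x. indicator \<Omega> x *\<^sub>R f x) = f"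
    using assms(3) by (auto simp: fun_eq_iff indicator_def)
  finally show ?thesis using assms(2) by (simp add: integral_completion)
qed

lemma partial_difference_quotient:
  assumes "\<And>x. \<phi> differentiable (at x)" and "t > 0"
  obtains z where "0 < z" "z < t" "\<phi> (x + t *\<^sub>R axis i 1) - \<phi> x = t * partial i \<phi> (x + z *\<^sub>R axis i 1)"
proof -
  have "((\<lambda>s. \<phi> (x + s *\<^sub>R axis i 1)) has_real_derivative partial i \<phi> (x + s *\<^sub>R axis i 1)) (at s)" for s
  proof -
    have l: "((\<lambda>s. x + s *\<^sub>R axis i 1) has_derivative (\<lambda>h. h *\<^sub>R axis i (1::real))) (at s)"
      by (auto intro!: derivative_eq_intros)
    have D: "(\<phi> has_derivative frechet_derivative \<phi> (at (x + s *\<^sub>R axis i 1))) (at (x + s *\<^sub>R axis i 1))"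
      by (rule has_derivative_partial[OF assms(1)])
    have "((\<lambda>s. \<phi> (x + s *\<^sub>R axis i 1)) has_derivative
        (\<lambda>h. frechet_derivative \<phi> (at (x + s *\<^sub>R axis i 1)) (h *\<^sub>R axis i 1))) (at s)"
      by (rule has_derivative_compose[OF l D])
    moreover have "frechet_derivative \<phi> (at (x + s *\<^sub>R axis i 1)) (h *\<^sub>R axis i 1)
        = partial i \<phi> (x + s *\<^sub>R axis i 1) * h" for h
      using has_derivative_linear[OF D] by (simp add: linear_cmul partial_def)
    ultimately show ?thesis by (simp add: has_field_derivative_def)
  qed
  from MVT2[OF \<open>t > 0\<close> this] obtain z where "0 < z" "z < t"
    "\<phi> (x + t *\<^sub>R axis i 1) - \<phi> (x + 0 *\<^sub>R axis i 1) = (t - 0) * partial i \<phi> (x + z *\<^sub>R axis i 1)"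
    by blast
  then show ?thesis by (intro that) auto
qed

text \<open>
  The integral of \<open>\<phi>\<close> over the whole space is invariant under translation, so the difference
  quotients of \<open>\<phi>\<close> in direction \<open>i\<close> integrate to zero. By the mean value theorem they are values of
  \<open>partial i \<phi>\<close> at nearby points; hence they are bounded, vanish outside a fixed ball, and
  converge to \<open>partial i \<phi>\<close>.
\<close>

lemma integral_partial_test_fun:
  fixes \<phi> :: "real^'d \<Rightarrow> real"
  assumes \<Omega>: "\<Omega> \<in> sets lebesgue" and \<phi>: "\<phi> \<in> test_fun \<Omega>"
  shows "(LINT x|lebesgue_on \<Omega>. partial i \<phi> x) = 0"
proof -
  note cont = test_fun_continuous[OF \<phi>] and pcont = test_fun_partial_continuous[OF \<phi>, of i]
  have [measurable]: "\<phi> \<in> borel_measurable borel" "partial i \<phi> \<in> borel_measurable borel"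
    using cont pcont by (auto intro: borel_measurable_continuous_onI)
  define e :: "real^'d" where "e = axis i 1"
  define t where "t n = inverse (real (Suc n))" for n
  define q where "q n x = (\<phi> (x + t n *\<^sub>R e) - \<phi> x) / t n" for n x
  have t: "0 < t n" "t n \<le> 1" for n by (auto simp: t_def inverse_le_1_iff)
  have tl: "t \<longlonglongrightarrow> 0" unfolding t_def using LIMSEQ_inverse_real_of_nat by simp
  obtain C where C: "0 \<le> C" "\<And>x. \<bar>partial i \<phi> x\<bar> \<le> C"
    using continuous_compact_support_bounded[OF pcont test_fun_support(1)[OF \<phi>]]
      partial_not_in_support by metis
  obtain R where R: "\<And>x. x \<in> support \<phi> \<Longrightarrow> norm x \<le> R"
    using test_fun_support(1)[OF \<phi>] compact_imp_bounded bounded_iff by metis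
  have mv: "\<exists>z. 0 < z \<and> z < t n \<and> q n x = partial i \<phi> (x + z *\<^sub>R e)" for n x
    using partial_difference_quotient[OF test_fun_differentiable[OF \<phi>] t(1)[of n], of x i] t(1)[of n]
    unfolding q_def e_def by (metis nonzero_mult_div_cancel_left less_irrefl)
  have int_shift: "integrable lborel (\<lambda>x. \<phi> (x + c))"
      "(LINT x|lborel. \<phi> (x + c)) = (LINT x|lborel. \<phi> x)" for c
  proof -
    have "integrable lborel \<phi>"
      by (rule continuous_compact_support_integrable[OF cont test_fun_support(1)[OF \<phi>]])
        (rule not_in_support)
    then have "integrable (distr lborel borel ((+) c)) \<phi>" by (simp add: lborel_distr_plus)
    then show "integrable lborel (\<lambda>x. \<phi> (x + c))"
      by (subst (asm) integrable_distr_eq) (auto simp: add.commute)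
    have "(LINT x|lborel. \<phi> x) = (LINT x|distr lborel borel ((+) c). \<phi> x)"
      by (simp add: lborel_distr_plus)
    then show "(LINT x|lborel. \<phi> (x + c)) = (LINT x|lborel. \<phi> x)"
      by (subst (asm) integral_distr) (auto simp: add.commute)
  qed
  have "(\<lambda>n. LINT x|lborel. q n x) \<longlonglongrightarrow> (LINT x|lborel. partial i \<phi> x)"
  proof (rule integral_dominated_convergence[where w="\<lambda>x. C * indicator (cball 0 (R + 1)) x"])
    show "partial i \<phi> \<in> borel_measurable lborel" by measurable
    show "q n \<in> borel_measurable lborel" for n unfolding q_def by measurable
    have "integrable lborel (indicator (cball (0::real^'d) (R + 1)) :: _ \<Rightarrow> real)"
      by (rule integrable_real_indicator) (use emeasure_bounded_finite[OF bounded_cball] in auto)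
    then show "integrable lborel (\<lambda>x::real^'d. C * indicator (cball 0 (R + 1)) x)" by simp
    show "AE x in lborel. (\<lambda>n. q n x) \<longlonglongrightarrow> partial i \<phi> x"
    proof (rule AE_I2)
      fix x
      from mv[of _ x] obtain z where z: "\<And>n. 0 < z n" "\<And>n. z n < t n"
        "\<And>n. q n x = partial i \<phi> (x + z n *\<^sub>R e)" by metis
      have "z \<longlonglongrightarrow> 0"
        by (rule tendsto_sandwich[OF _ _ tendsto_const tl])
          (use z in \<open>auto intro!: always_eventually less_imp_le\<close>)
      then have "(\<lambda>n. x + z n *\<^sub>R e) \<longlonglongrightarrow> x + 0 *\<^sub>R e" by (intro tendsto_intros)
      then have "(\<lambda>n. partial i \<phi> (x + z n *\<^sub>R e)) \<longlonglongrightarrow> partial i \<phi> (x + 0 *\<^sub>R e)"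
        by (rule continuous_on_tendsto_compose[OF pcont]) simp_all
      then show "(\<lambda>n. q n x) \<longlonglongrightarrow> partial i \<phi> x" by (simp add: z(3))
    qed
    show "AE x in lborel. norm (q n x) \<le> C * indicator (cball 0 (R + 1)) x" for n
    proof (rule AE_I2)
      fix x
      obtain z where z: "0 < z" "z < t n" "q n x = partial i \<phi> (x + z *\<^sub>R e)" using mv by blast
      show "norm (q n x) \<le> C * indicator (cball 0 (R + 1)) x"
      proof (cases "x \<in> cball 0 (R + 1)")
        case False
        have "norm (z *\<^sub>R e) \<le> 1" using z t(2)[of n] by (simp add: e_def norm_axis_1)
        then have "R < norm (x + z *\<^sub>R e)"
          using False norm_triangle_ineq4[of "x + z *\<^sub>R e" "z *\<^sub>R e"] by simp
        then have "x + z *\<^sub>R e \<notin> support \<phi>" using R[of "x + z *\<^sub>R e"] by auto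
        then show ?thesis using z(3) partial_not_in_support[of "x + z *\<^sub>R e" \<phi> i] False by simp
      qed (use C(2)[of "x + z *\<^sub>R e"] z(3) in simp)
    qed
  qed
  moreover have "(LINT x|lborel. q n x) = 0" for n
    unfolding q_def using int_shift[of "t n *\<^sub>R e"] int_shift[of 0] by simp
  ultimately have "(LINT x|lborel. partial i \<phi> x) = 0" by (simp add: LIMSEQ_const_iff)
  moreover have "partial i \<phi> x = 0" if "x \<notin> \<Omega>" for x
    using that test_fun_support(2)[OF \<phi>] by (intro partial_not_in_support) auto
  ultimately show ?thesis using \<Omega> by (simp add: lebesgue_on_integral_eq_lborel)
qed

section \<open>Weak gradients\<close>

locale bounded_open =
  fixes \<Omega> :: "(real^'d) set"
  assumes open_\<Omega>: "open \<Omega>" and bounded_\<Omega>: "bounded \<Omega>"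
begin

lemma sets_\<Omega>: "\<Omega> \<in> sets lebesgue"
  using open_\<Omega> by auto

lemma integrable_const_\<Omega>: "integrable (lebesgue_on \<Omega>) (\<lambda>x. c :: real)"
proof -
  have "\<Omega> \<in> lmeasurable" using open_\<Omega> bounded_\<Omega> by (simp add: lmeasurable_open)
  then show ?thesis by (simp add: finite_measure.integrable_const finite_measure_lebesgue_on)
qed

lemma L2_bounded:
  assumes "u \<in> borel_measurable (lebesgue_on \<Omega>)" "\<And>x. x \<in> \<Omega> \<Longrightarrow> norm (u x) \<le> C"
  shows "u \<in> L2 \<Omega>"
proof -
  have "(\<lambda>x. 1 :: real) \<in> L2 \<Omega>" using integrable_const_\<Omega>[of 1] by (simp add: L2_def)
  then show ?thesis by (rule L2_bound[where C=C]) (use assms in auto)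
qed

lemma L2_continuous_compact_support:
  fixes f :: "real^'d \<Rightarrow> real"
  assumes "continuous_on UNIV f" "compact K" "\<And>x. x \<notin> K \<Longrightarrow> f x = 0"
  shows "f \<in> L2 \<Omega>"
proof -
  obtain C where "\<And>x. \<bar>f x\<bar> \<le> C" using continuous_compact_support_bounded[OF assms] by metis
  moreover have "f \<in> borel_measurable (lebesgue_on \<Omega>)"
    using borel_measurable_continuous_onI[OF assms(1)]
    by (simp add: measurable_completion measurable_restrict_space1)
  ultimately show ?thesis by (intro L2_bounded) auto
qed

lemma test_fun_L2:
  assumes "\<phi> \<in> test_fun \<Omega>" shows "\<phi> \<in> L2 \<Omega>" "partial i \<phi> \<in> L2 \<Omega>"
proof -
  show "\<phi> \<in> L2 \<Omega>"
    by (rule L2_continuous_compact_support[OF test_fun_continuous[OF assms] test_fun_support(1)[OF assms]])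
      (rule not_in_support)
  show "partial i \<phi> \<in> L2 \<Omega>"
    by (rule L2_continuous_compact_support[OF test_fun_partial_continuous[OF assms] test_fun_support(1)[OF assms]])
      (rule partial_not_in_support)
qed

lemma L2_mult_integrable:
  fixes u v :: "real^'d \<Rightarrow> real"
  assumes "u \<in> L2 \<Omega>" "v \<in> L2 \<Omega>" shows "integrable (lebesgue_on \<Omega>) (\<lambda>x. u x * v x)"
  using L2_product_integrable[OF assms] by simp

lemma L2_integrable:
  fixes u :: "real^'d \<Rightarrow> real"
  assumes "u \<in> L2 \<Omega>" shows "integrable (lebesgue_on \<Omega>) u"
proof -
  have "(\<lambda>x. 1 :: real) \<in> L2 \<Omega>" using integrable_const_\<Omega>[of 1] by (simp add: L2_def)
  from L2_mult_integrable[OF assms this] show ?thesis by simp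
qed

text \<open>
  Integration by parts: the product of two test functions is a test function, and its partial
  derivatives have integral zero.
\<close>

lemma has_weak_grad_test_fun:
  assumes \<phi>: "\<phi> \<in> test_fun \<Omega>"
  shows "has_weak_grad \<Omega> \<phi> (\<lambda>x. \<chi> i. partial i \<phi> x)"
  unfolding has_weak_grad_def
proof (intro ballI allI)
  fix \<psi> i assume \<psi>: "\<psi> \<in> test_fun \<Omega>"
  have "(LINT x|lebesgue_on \<Omega>. partial i (\<lambda>x. \<phi> x * \<psi> x) x) = 0"
    by (rule integral_partial_test_fun[OF sets_\<Omega> test_fun_mult[OF \<phi> \<psi>]])
  moreover have "partial i (\<lambda>x. \<phi> x * \<psi> x) x = \<phi> x * partial i \<psi> x + partial i \<phi> x * \<psi> x" for x
    by (rule partial_mult[OF test_fun_differentiable[OF \<phi>] test_fun_differentiable[OF \<psi>]])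
  moreover have "integrable (lebesgue_on \<Omega>) (\<lambda>x. \<phi> x * partial i \<psi> x)"
      "integrable (lebesgue_on \<Omega>) (\<lambda>x. partial i \<phi> x * \<psi> x)"
    by (intro L2_mult_integrable test_fun_L2 \<phi> \<psi>)+
  ultimately show "(LINT x|lebesgue_on \<Omega>. \<phi> x * partial i \<psi> x)
      = - (LINT x|lebesgue_on \<Omega>. (\<chi> i. partial i \<phi> x) $ i * \<psi> x)"
    by simp
qed

lemma has_weak_grad_unique:
  assumes "has_weak_grad \<Omega> u g" "has_weak_grad \<Omega> u h" and g: "g \<in> L2 \<Omega>" and h: "h \<in> L2 \<Omega>"
  shows "AE x in lebesgue_on \<Omega>. g x = h x"
proof -
  have "AE x in lebesgue_on \<Omega>. g x $ i - h x $ i = 0" for i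
  proof (rule fundamental_lemma_of_variations[OF open_\<Omega>])
    note gh = L2_component[OF g, of i] L2_component[OF h, of i]
    from L2_diff[OF gh] show "integrable (lebesgue_on \<Omega>) (\<lambda>x. g x $ i - h x $ i)"
      by (rule L2_integrable)
    fix \<phi> assume \<phi>: "\<phi> \<in> test_fun \<Omega>"
    have "(LINT x|lebesgue_on \<Omega>. g x $ i * \<phi> x) = (LINT x|lebesgue_on \<Omega>. h x $ i * \<phi> x)"
      using bspec[OF assms(1)[unfolded has_weak_grad_def] \<phi>, THEN spec, of i]
        bspec[OF assms(2)[unfolded has_weak_grad_def] \<phi>, THEN spec, of i] by simp
    then show "(LINT x|lebesgue_on \<Omega>. (g x $ i - h x $ i) * \<phi> x) = 0"
      using L2_mult_integrable[OF gh(1) test_fun_L2(1)[OF \<phi>]]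
        L2_mult_integrable[OF gh(2) test_fun_L2(1)[OF \<phi>]]
      by (simp add: left_diff_distrib)
  qed
  then have "AE x in lebesgue_on \<Omega>. \<forall>i. g x $ i - h x $ i = 0"
    by (simp add: AE_all_countable)
  then show ?thesis by eventually_elim (simp add: vec_eq_iff)
qed

lemma has_weak_grad_lincomb:
  assumes "has_weak_grad \<Omega> u g" "has_weak_grad \<Omega> v h"
    and "u \<in> L2 \<Omega>" "v \<in> L2 \<Omega>" "g \<in> L2 \<Omega>" "h \<in> L2 \<Omega>"
  shows "has_weak_grad \<Omega> (\<lambda>x. a * u x + b * v x) (\<lambda>x. a *\<^sub>R g x + b *\<^sub>R h x)"
  unfolding has_weak_grad_def
proof (intro ballI allI)
  fix \<phi> i assume \<phi>: "\<phi> \<in> test_fun \<Omega>"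
  have I: "integrable (lebesgue_on \<Omega>) (\<lambda>x. u x * partial i \<phi> x)"
    "integrable (lebesgue_on \<Omega>) (\<lambda>x. v x * partial i \<phi> x)"
    "integrable (lebesgue_on \<Omega>) (\<lambda>x. g x $ i * \<phi> x)"
    "integrable (lebesgue_on \<Omega>) (\<lambda>x. h x $ i * \<phi> x)"
    by (intro L2_mult_integrable test_fun_L2 \<phi> assms L2_component)+
  have "(LINT x|lebesgue_on \<Omega>. (a * u x + b * v x) * partial i \<phi> x)
      = a * (LINT x|lebesgue_on \<Omega>. u x * partial i \<phi> x) + b * (LINT x|lebesgue_on \<Omega>. v x * partial i \<phi> x)"
    using I(1,2) by (simp add: distrib_right mult.assoc)
  also have "\<dots> = - (a * (LINT x|lebesgue_on \<Omega>. g x $ i * \<phi> x) + b * (LINT x|lebesgue_on \<Omega>. h x $ i * \<phi> x))"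
    using assms(1,2) \<phi> by (simp add: has_weak_grad_def)
  also have "\<dots> = - (LINT x|lebesgue_on \<Omega>. (a *\<^sub>R g x + b *\<^sub>R h x) $ i * \<phi> x)"
    using I(3,4) by (simp add: distrib_right mult.assoc)
  finally show "(LINT x|lebesgue_on \<Omega>. (a * u x + b * v x) * partial i \<phi> x)
      = - (LINT x|lebesgue_on \<Omega>. (a *\<^sub>R g x + b *\<^sub>R h x) $ i * \<phi> x)" .
qed

lemma H1_weak_grad:
  assumes "u \<in> H1 \<Omega>"
  shows "u \<in> L2 \<Omega>" "weak_grad \<Omega> u \<in> L2 \<Omega>" "has_weak_grad \<Omega> u (weak_grad \<Omega> u)"
proof -
  have "\<exists>g. g \<in> L2 \<Omega> \<and> has_weak_grad \<Omega> u g" using assms by (auto simp: H1_def)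
  from someI_ex[OF this] show "weak_grad \<Omega> u \<in> L2 \<Omega>" "has_weak_grad \<Omega> u (weak_grad \<Omega> u)"
    by (auto simp: weak_grad_def)
qed (use assms in \<open>simp add: H1_def\<close>)

lemma weak_grad_eqI:
  assumes "u \<in> L2 \<Omega>" "g \<in> L2 \<Omega>" "has_weak_grad \<Omega> u g"
  shows "u \<in> H1 \<Omega>" "AE x in lebesgue_on \<Omega>. weak_grad \<Omega> u x = g x"
proof -
  show "u \<in> H1 \<Omega>" using assms by (auto simp: H1_def)
  from H1_weak_grad[OF this] assms show "AE x in lebesgue_on \<Omega>. weak_grad \<Omega> u x = g x"
    by (intro has_weak_grad_unique)
qed

lemma weak_grad_lincomb:
  assumes u: "u \<in> H1 \<Omega>" and v: "v \<in> H1 \<Omega>"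
  shows "(\<lambda>x. a * u x + b * v x) \<in> H1 \<Omega>"
    and "AE x in lebesgue_on \<Omega>. weak_grad \<Omega> (\<lambda>x. a * u x + b * v x) x
            = a *\<^sub>R weak_grad \<Omega> u x + b *\<^sub>R weak_grad \<Omega> v x"
proof -
  note U = H1_weak_grad[OF u] and V = H1_weak_grad[OF v]
  have 1: "(\<lambda>x. a * u x + b * v x) \<in> L2 \<Omega>"
    using L2_lincomb[OF U(1) V(1)] by simp
  have 2: "(\<lambda>x. a *\<^sub>R weak_grad \<Omega> u x + b *\<^sub>R weak_grad \<Omega> v x) \<in> L2 \<Omega>"
    by (rule L2_lincomb[OF U(2) V(2)])
  have 3: "has_weak_grad \<Omega> (\<lambda>x. a * u x + b * v x) (\<lambda>x. a *\<^sub>R weak_grad \<Omega> u x + b *\<^sub>R weak_grad \<Omega> v x)"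
    by (rule has_weak_grad_lincomb) (use U V in auto)
  show "(\<lambda>x. a * u x + b * v x) \<in> H1 \<Omega>"
    and "AE x in lebesgue_on \<Omega>. weak_grad \<Omega> (\<lambda>x. a * u x + b * v x) x
            = a *\<^sub>R weak_grad \<Omega> u x + b *\<^sub>R weak_grad \<Omega> v x"
    by (rule weak_grad_eqI[OF 1 2 3])+
qed

lemma weak_grad_test_fun:
  assumes \<phi>: "\<phi> \<in> test_fun \<Omega>"
  shows "\<phi> \<in> H1 \<Omega>" "AE x in lebesgue_on \<Omega>. weak_grad \<Omega> \<phi> x = (\<chi> i. partial i \<phi> x)"
  using weak_grad_eqI[OF test_fun_L2(1)[OF \<phi>] L2_vec_lambda[OF test_fun_L2(2)[OF \<phi>]]
      has_weak_grad_test_fun[OF \<phi>]] by auto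

text \<open>
  The zero field is a weak gradient of \<open>u\<close>, so uniqueness identifies it with the chosen one.
\<close>

lemma weak_grad_null:
  assumes u: "u \<in> H1 \<Omega>" and z: "AE x in lebesgue_on \<Omega>. u x = 0"
  shows "AE x in lebesgue_on \<Omega>. weak_grad \<Omega> u x = 0"
proof (rule weak_grad_eqI(2)[OF H1_weak_grad(1)[OF u] L2_zero])
  show "has_weak_grad \<Omega> u (\<lambda>x. 0)"
    unfolding has_weak_grad_def
  proof (intro ballI allI)
    fix \<phi> i assume \<phi>: "\<phi> \<in> test_fun \<Omega>"
    have "(LINT x|lebesgue_on \<Omega>. u x * partial i \<phi> x) = (LINT x|lebesgue_on \<Omega>. 0)"
    proof (rule integral_cong_AE)
      show "(\<lambda>x. u x * partial i \<phi> x) \<in> borel_measurable (lebesgue_on \<Omega>)"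
        by (rule borel_measurable_integrable[OF L2_mult_integrable[OF H1_weak_grad(1)[OF u] test_fun_L2(2)[OF \<phi>]]])
      show "AE x in lebesgue_on \<Omega>. u x * partial i \<phi> x = 0"
        using z by eventually_elim simp
    qed simp
    then show "(LINT x|lebesgue_on \<Omega>. u x * partial i \<phi> x) = - (LINT x|lebesgue_on \<Omega>. 0 $ i * \<phi> x)"
      by simp
  qed
qed

section \<open>The space of functions vanishing on the boundary\<close>

lemma H1_norm_nonneg: "0 \<le> H1_norm \<Omega> u"
  by (simp add: H1_norm_def)

lemma nrm_weak_grad_le_H1_norm: "nrm \<Omega> (weak_grad \<Omega> u) \<le> H1_norm \<Omega> u"
  unfolding H1_norm_def by (rule real_le_rsqrt) simp

lemma nrm_lincomb_le:
  assumes "u \<in> L2 \<Omega>" "v \<in> L2 \<Omega>"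
  shows "nrm \<Omega> (\<lambda>x. a *\<^sub>R u x + b *\<^sub>R v x) \<le> \<bar>a\<bar> * nrm \<Omega> u + \<bar>b\<bar> * nrm \<Omega> v"
  using nrm_add_le[OF L2_scale[OF assms(1), of a] L2_scale[OF assms(2), of b]] by (simp add: nrm_scale)

lemma nrm_weak_grad_lincomb:
  assumes u: "u \<in> H1 \<Omega>" and v: "v \<in> H1 \<Omega>"
  shows "nrm \<Omega> (weak_grad \<Omega> (\<lambda>x. a * u x + b * v x))
    = nrm \<Omega> (\<lambda>x. a *\<^sub>R weak_grad \<Omega> u x + b *\<^sub>R weak_grad \<Omega> v x)"
  by (rule nrm_cong_AE[OF weak_grad_lincomb(2)[OF u v] H1_weak_grad(2)[OF weak_grad_lincomb(1)[OF u v]]])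
    (rule L2_lincomb[OF H1_weak_grad(2)[OF u] H1_weak_grad(2)[OF v]])

lemma H1_norm_lincomb_le:
  assumes u: "u \<in> H1 \<Omega>" and v: "v \<in> H1 \<Omega>"
  shows "H1_norm \<Omega> (\<lambda>x. a * u x + b * v x) \<le> \<bar>a\<bar> * H1_norm \<Omega> u + \<bar>b\<bar> * H1_norm \<Omega> v"
proof -
  have 1: "nrm \<Omega> (\<lambda>x. a * u x + b * v x) \<le> \<bar>a\<bar> * nrm \<Omega> u + \<bar>b\<bar> * nrm \<Omega> v"
    using nrm_lincomb_le[OF H1_weak_grad(1)[OF u] H1_weak_grad(1)[OF v], of a b] by simp
  have 2: "nrm \<Omega> (weak_grad \<Omega> (\<lambda>x. a * u x + b * v x))
      \<le> \<bar>a\<bar> * nrm \<Omega> (weak_grad \<Omega> u) + \<bar>b\<bar> * nrm \<Omega> (weak_grad \<Omega> v)"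
    unfolding nrm_weak_grad_lincomb[OF u v]
    by (rule nrm_lincomb_le[OF H1_weak_grad(2)[OF u] H1_weak_grad(2)[OF v]])
  have "H1_norm \<Omega> (\<lambda>x. a * u x + b * v x)
      \<le> sqrt ((\<bar>a\<bar> * nrm \<Omega> u + \<bar>b\<bar> * nrm \<Omega> v)\<^sup>2
            + (\<bar>a\<bar> * nrm \<Omega> (weak_grad \<Omega> u) + \<bar>b\<bar> * nrm \<Omega> (weak_grad \<Omega> v))\<^sup>2)"
    unfolding H1_norm_def
    by (intro real_sqrt_le_mono add_mono power_mono 1 2 nrm_nonneg)
  also have "\<dots> \<le> sqrt ((\<bar>a\<bar> * nrm \<Omega> u)\<^sup>2 + (\<bar>a\<bar> * nrm \<Omega> (weak_grad \<Omega> u))\<^sup>2)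
      + sqrt ((\<bar>b\<bar> * nrm \<Omega> v)\<^sup>2 + (\<bar>b\<bar> * nrm \<Omega> (weak_grad \<Omega> v))\<^sup>2)"
    by (rule real_sqrt_sum_squares_triangle_ineq)
  also have "\<dots> = \<bar>a\<bar> * H1_norm \<Omega> u + \<bar>b\<bar> * H1_norm \<Omega> v"
    by (simp add: H1_norm_def power_mult_distrib distrib_left[symmetric] real_sqrt_mult)
  finally show ?thesis .
qed

lemma H1_diff:
  assumes "u \<in> H1 \<Omega>" "v \<in> H1 \<Omega>" shows "(\<lambda>x. u x - v x) \<in> H1 \<Omega>"
  using weak_grad_lincomb(1)[OF assms, of 1 "-1"] by simp

lemma H1_0D:
  assumes "u \<in> H1_0 \<Omega>"
  obtains \<phi> where "u \<in> H1 \<Omega>" "\<And>n::nat. \<phi> n \<in> test_fun \<Omega>"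
    "(\<lambda>n. H1_norm \<Omega> (\<lambda>x. \<phi> n x - u x)) \<longlonglongrightarrow> 0"
  using assms unfolding H1_0_def mem_Collect_eq by (elim conjE exE) (rule that, auto)

lemma H1_0_lincomb:
  assumes "u \<in> H1_0 \<Omega>" "v \<in> H1_0 \<Omega>"
  shows "(\<lambda>x. a * u x + b * v x) \<in> H1_0 \<Omega>"
proof -
  obtain \<phi> where u: "u \<in> H1 \<Omega>" and \<phi>: "\<And>n::nat. \<phi> n \<in> test_fun \<Omega>"
    and lu: "(\<lambda>n. H1_norm \<Omega> (\<lambda>x. \<phi> n x - u x)) \<longlonglongrightarrow> 0"
    by (rule H1_0D[OF assms(1)]) blast
  obtain \<psi> where v: "v \<in> H1 \<Omega>" and \<psi>: "\<And>n::nat. \<psi> n \<in> test_fun \<Omega>"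
    and lv: "(\<lambda>n. H1_norm \<Omega> (\<lambda>x. \<psi> n x - v x)) \<longlonglongrightarrow> 0"
    by (rule H1_0D[OF assms(2)]) blast
  let ?d = "\<lambda>n x. (a * \<phi> n x + b * \<psi> n x) - (a * u x + b * v x)"
  have le: "H1_norm \<Omega> (?d n)
      \<le> \<bar>a\<bar> * H1_norm \<Omega> (\<lambda>x. \<phi> n x - u x) + \<bar>b\<bar> * H1_norm \<Omega> (\<lambda>x. \<psi> n x - v x)" for n
  proof -
    have "?d n = (\<lambda>x. a * (\<phi> n x - u x) + b * (\<psi> n x - v x))"
      by (simp add: algebra_simps)
    then show ?thesis
      using H1_norm_lincomb_le[OF H1_diff[OF weak_grad_test_fun(1)[OF \<phi>] u]
          H1_diff[OF weak_grad_test_fun(1)[OF \<psi>] v], of a n b n] by simp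
  qed
  have "(\<lambda>n. \<bar>a\<bar> * H1_norm \<Omega> (\<lambda>x. \<phi> n x - u x) + \<bar>b\<bar> * H1_norm \<Omega> (\<lambda>x. \<psi> n x - v x))
      \<longlonglongrightarrow> \<bar>a\<bar> * 0 + \<bar>b\<bar> * 0"
    by (intro tendsto_add tendsto_mult tendsto_const lu lv)
  then have up: "(\<lambda>n. \<bar>a\<bar> * H1_norm \<Omega> (\<lambda>x. \<phi> n x - u x) + \<bar>b\<bar> * H1_norm \<Omega> (\<lambda>x. \<psi> n x - v x))
      \<longlonglongrightarrow> 0" by simp
  have "(\<lambda>n. H1_norm \<Omega> (?d n)) \<longlonglongrightarrow> 0"
    by (rule tendsto_sandwich[OF always_eventually always_eventually tendsto_const up])
      (intro allI H1_norm_nonneg, intro allI le)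
  moreover have "(\<lambda>x. a * \<phi> n x + b * \<psi> n x) \<in> test_fun \<Omega>" for n
    by (rule test_fun_lincomb[OF \<phi> \<psi>])
  ultimately show ?thesis
    using weak_grad_lincomb(1)[OF u v, of a b] unfolding H1_0_def mem_Collect_eq
    by (intro conjI exI[of _ "\<lambda>n x. a * \<phi> n x + b * \<psi> n x"]) auto
qed

lemma test_fun_H1_0:
  assumes \<phi>: "\<phi> \<in> test_fun \<Omega>" shows "\<phi> \<in> H1_0 \<Omega>"
proof -
  have z: "(\<lambda>x. 0 :: real) \<in> H1 \<Omega>"
    using weak_grad_lincomb(1)[OF weak_grad_test_fun(1)[OF \<phi>] weak_grad_test_fun(1)[OF \<phi>], of 0 0] by simp
  have "nrm \<Omega> (weak_grad \<Omega> (\<lambda>x. 0)) = nrm \<Omega> (\<lambda>x. 0 :: real^'d)"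
    by (rule nrm_cong_AE[OF weak_grad_null[OF z] H1_weak_grad(2)[OF z] L2_zero]) simp
  then have "H1_norm \<Omega> (\<lambda>x. \<phi> x - \<phi> x) = 0"
    by (simp add: H1_norm_def nrm_zero)
  then show ?thesis
    using \<phi> weak_grad_test_fun(1)[OF \<phi>] unfolding H1_0_def mem_Collect_eq
    by (intro conjI exI[of _ "\<lambda>n. \<phi>"]) auto
qed

section \<open>Vector fields\<close>

lemma Xsp_component:
  assumes "v \<in> Xsp \<Omega>" shows "(\<lambda>x. v x $ i) \<in> H1_0 \<Omega>" "(\<lambda>x. v x $ i) \<in> H1 \<Omega>"
proof -
  show "(\<lambda>x. v x $ i) \<in> H1_0 \<Omega>" using assms unfolding Xsp_def by blast
  then show "(\<lambda>x. v x $ i) \<in> H1 \<Omega>" unfolding H1_0_def by blast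
qed

lemma Xsp_L2:
  assumes "v \<in> Xsp \<Omega>" shows "v \<in> L2 \<Omega>"
  using L2_vec_lambda[of "\<lambda>i x. v x $ i", OF H1_weak_grad(1)[OF Xsp_component(2)[OF assms]]] by simp

lemma grad_L2:
  assumes "v \<in> Xsp \<Omega>" shows "grad \<Omega> v \<in> L2 \<Omega>"
  using L2_vec_lambda[OF H1_weak_grad(2)[OF Xsp_component(2)[OF assms]]]
  unfolding grad_def[abs_def] .

lemma Xsp_lincomb:
  assumes "u \<in> Xsp \<Omega>" "v \<in> Xsp \<Omega>"
  shows "(\<lambda>x. a *\<^sub>R u x + b *\<^sub>R v x) \<in> Xsp \<Omega>"
  using H1_0_lincomb[OF Xsp_component(1)[OF assms(1)] Xsp_component(1)[OF assms(2)], of a _ b]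
  unfolding Xsp_def by simp

lemma grad_lincomb:
  assumes "u \<in> Xsp \<Omega>" "v \<in> Xsp \<Omega>"
  shows "AE x in lebesgue_on \<Omega>. grad \<Omega> (\<lambda>x. a *\<^sub>R u x + b *\<^sub>R v x) x
           = a *\<^sub>R grad \<Omega> u x + b *\<^sub>R grad \<Omega> v x"
proof -
  have "AE x in lebesgue_on \<Omega>. weak_grad \<Omega> (\<lambda>x. a * u x $ i + b * v x $ i) x
      = a *\<^sub>R weak_grad \<Omega> (\<lambda>x. u x $ i) x + b *\<^sub>R weak_grad \<Omega> (\<lambda>x. v x $ i) x" for i
    by (rule weak_grad_lincomb(2)[OF Xsp_component(2)[OF assms(1)] Xsp_component(2)[OF assms(2)]])
  then have "AE x in lebesgue_on \<Omega>. \<forall>i. weak_grad \<Omega> (\<lambda>x. a * u x $ i + b * v x $ i) x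
      = a *\<^sub>R weak_grad \<Omega> (\<lambda>x. u x $ i) x + b *\<^sub>R weak_grad \<Omega> (\<lambda>x. v x $ i) x"
    by (simp add: AE_all_countable)
  then show ?thesis by eventually_elim (simp add: grad_def vec_eq_iff)
qed

lemma ip_grad_lincomb_left:
  assumes u: "u \<in> Xsp \<Omega>" and v: "v \<in> Xsp \<Omega>" and w: "w \<in> Xsp \<Omega>"
  shows "ip \<Omega> (grad \<Omega> (\<lambda>x. a *\<^sub>R u x + b *\<^sub>R v x)) (grad \<Omega> w)
    = a * ip \<Omega> (grad \<Omega> u) (grad \<Omega> w) + b * ip \<Omega> (grad \<Omega> v) (grad \<Omega> w)"
proof -
  have "ip \<Omega> (grad \<Omega> (\<lambda>x. a *\<^sub>R u x + b *\<^sub>R v x)) (grad \<Omega> w)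
      = ip \<Omega> (\<lambda>x. a *\<^sub>R grad \<Omega> u x + b *\<^sub>R grad \<Omega> v x) (grad \<Omega> w)"
    by (rule ip_cong_AE[OF grad_lincomb[OF u v] AE_I2[OF refl] grad_L2[OF Xsp_lincomb[OF u v]] grad_L2[OF w]
          L2_lincomb[OF grad_L2[OF u] grad_L2[OF v]] grad_L2[OF w]])
  then show ?thesis by (simp add: ip_lincomb_left grad_L2 u v w)
qed

lemma dvg_lincomb_null:
  assumes "u \<in> Xsp \<Omega>" "v \<in> Xsp \<Omega>"
    and "AE x in lebesgue_on \<Omega>. dvg \<Omega> u x = 0" "AE x in lebesgue_on \<Omega>. dvg \<Omega> v x = 0"
  shows "AE x in lebesgue_on \<Omega>. dvg \<Omega> (\<lambda>x. a *\<^sub>R u x + b *\<^sub>R v x) x = 0"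
  using grad_lincomb[OF assms(1,2), of a b] assms(3,4)
proof eventually_elim
  case (elim x)
  then show ?case
    by (simp add: dvg_def trace_def sum.distrib sum_distrib_left[symmetric])
qed

text \<open>
  Boundedness of the advecting field is what makes the products integrable, so that the
  convective form is bilinear in its last two arguments.
\<close>

lemma conv_L2:
  assumes u: "u \<in> Xsp \<Omega>" and b: "b \<in> Xsp \<Omega>" and C: "\<And>x. x \<in> \<Omega> \<Longrightarrow> norm (u x) \<le> C"
  shows "conv \<Omega> u b \<in> L2 \<Omega>"
proof -
  let ?g = "\<lambda>i. weak_grad \<Omega> (\<lambda>x. b x $ i)"
  have g: "?g i \<in> L2 \<Omega>" for i
    by (rule H1_weak_grad(2)[OF Xsp_component(2)[OF b]])
  have "(\<lambda>x. ?g i x \<bullet> u x) \<in> L2 \<Omega>" for i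
  proof (rule L2_bound[OF g[of i]])
    show "(\<lambda>x. ?g i x \<bullet> u x) \<in> borel_measurable (lebesgue_on \<Omega>)"
      by (rule borel_measurable_inner[OF L2D(1)[OF g] L2D(1)[OF Xsp_L2[OF u]]])
    fix x assume "x \<in> \<Omega>"
    have "\<bar>?g i x \<bullet> u x\<bar> \<le> norm (?g i x) * norm (u x)" by (rule Cauchy_Schwarz_ineq2)
    also have "\<dots> \<le> norm (?g i x) * C" by (intro mult_left_mono C \<open>x \<in> \<Omega>\<close>) simp
    finally show "norm (?g i x \<bullet> u x) \<le> C * norm (?g i x)" by (simp add: mult.commute)
  qed
  from L2_vec_lambda[OF this] have "(\<lambda>x. \<chi> i. ?g i x \<bullet> u x) \<in> L2 \<Omega>" .
  moreover have "conv \<Omega> u b = (\<lambda>x. \<chi> i. ?g i x \<bullet> u x)"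
    by (simp add: fun_eq_iff vec_eq_iff conv_def grad_def matrix_vector_mult_def inner_vec_def)
  ultimately show ?thesis by simp
qed

lemma ip_conv_lincomb_middle:
  assumes u: "u \<in> Xsp \<Omega>" "\<And>x. x \<in> \<Omega> \<Longrightarrow> norm (u x) \<le> C"
    and b: "b \<in> Xsp \<Omega>" and c: "c \<in> Xsp \<Omega>" and w: "w \<in> Xsp \<Omega>"
  shows "ip \<Omega> (conv \<Omega> u (\<lambda>x. r *\<^sub>R b x + s *\<^sub>R c x)) w
    = r * ip \<Omega> (conv \<Omega> u b) w + s * ip \<Omega> (conv \<Omega> u c) w"
proof -
  note L = conv_L2[OF u(1) _ u(2)]
  have "AE x in lebesgue_on \<Omega>. conv \<Omega> u (\<lambda>x. r *\<^sub>R b x + s *\<^sub>R c x) x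
      = r *\<^sub>R conv \<Omega> u b x + s *\<^sub>R conv \<Omega> u c x"
    using grad_lincomb[OF b c, of r s]
    by eventually_elim
      (simp add: conv_def matrix_vector_mult_add_rdistrib scaleR_matrix_vector_assoc)
  then have "ip \<Omega> (conv \<Omega> u (\<lambda>x. r *\<^sub>R b x + s *\<^sub>R c x)) w
      = ip \<Omega> (\<lambda>x. r *\<^sub>R conv \<Omega> u b x + s *\<^sub>R conv \<Omega> u c x) w"
    by (rule ip_cong_AE[OF _ AE_I2[OF refl] L[OF Xsp_lincomb[OF b c]] Xsp_L2[OF w]
          L2_lincomb[OF L[OF b] L[OF c]] Xsp_L2[OF w]])
  then show ?thesis by (simp add: ip_lincomb_left L Xsp_L2 b c w)
qed

lemma test_field_Xsp:
  assumes "\<And>i. (\<lambda>x. \<Phi> x $ i) \<in> test_fun \<Omega>" shows "\<Phi> \<in> Xsp \<Omega>"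
  using test_fun_H1_0[OF assms] unfolding Xsp_def by blast

text \<open>
  Each integrand is one half of \<open>u\<^sub>j \<partial>\<^sub>j(\<psi>\<^sup>2)\<close>. Since \<open>\<psi>\<^sup>2\<close> is a test function, the definition of the
  weak gradient moves the derivative to \<open>u\<close>, and the sum over \<open>j\<close> produces the divergence of \<open>u\<close>.
\<close>

lemma advection_test_fun_skew:
  assumes u: "u \<in> Xsp \<Omega>" "AE x in lebesgue_on \<Omega>. dvg \<Omega> u x = 0"
    and \<psi>: "\<psi> \<in> test_fun \<Omega>"
  shows "(\<Sum>j\<in>UNIV. LINT x|lebesgue_on \<Omega>. partial j \<psi> x * u x $ j * \<psi> x) = 0"
proof -
  let ?g = "\<lambda>j x. weak_grad \<Omega> (\<lambda>x. u x $ j) x $ j"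
  note sq = test_fun_mult[OF \<psi> \<psi>]
  have "2 * (LINT x|lebesgue_on \<Omega>. partial j \<psi> x * u x $ j * \<psi> x)
      = - (LINT x|lebesgue_on \<Omega>. ?g j x * (\<psi> x * \<psi> x))" for j
  proof -
    have "2 * (LINT x|lebesgue_on \<Omega>. partial j \<psi> x * u x $ j * \<psi> x)
        = (LINT x|lebesgue_on \<Omega>. 2 * (partial j \<psi> x * u x $ j * \<psi> x))" by simp
    also have "\<dots> = (LINT x|lebesgue_on \<Omega>. u x $ j * partial j (\<lambda>x. \<psi> x * \<psi> x) x)"
      by (rule Bochner_Integration.integral_cong)
        (simp_all add: partial_mult[OF test_fun_differentiable[OF \<psi>] test_fun_differentiable[OF \<psi>]])
    also have "\<dots> = - (LINT x|lebesgue_on \<Omega>. ?g j x * (\<psi> x * \<psi> x))"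
      using bspec[OF H1_weak_grad(3)[OF Xsp_component(2)[OF u(1), of j], unfolded has_weak_grad_def] sq]
      by blast
    finally show ?thesis .
  qed
  then have "2 * (\<Sum>j\<in>UNIV. LINT x|lebesgue_on \<Omega>. partial j \<psi> x * u x $ j * \<psi> x)
      = - (\<Sum>j\<in>UNIV. LINT x|lebesgue_on \<Omega>. ?g j x * (\<psi> x * \<psi> x))"
    by (simp add: sum_distrib_left sum_negf)
  also have "(\<Sum>j\<in>UNIV. LINT x|lebesgue_on \<Omega>. ?g j x * (\<psi> x * \<psi> x))
      = (LINT x|lebesgue_on \<Omega>. (\<Sum>j\<in>UNIV. ?g j x * (\<psi> x * \<psi> x)))"
    by (rule Bochner_Integration.integral_sum[symmetric])
      (intro L2_mult_integrable L2_component H1_weak_grad(2) Xsp_component(2) u test_fun_L2(1) sq)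
  also have "\<dots> = (LINT x|lebesgue_on \<Omega>. 0)"
  proof (rule integral_cong_AE)
    show "(\<lambda>x. \<Sum>j\<in>UNIV. ?g j x * (\<psi> x * \<psi> x)) \<in> borel_measurable (lebesgue_on \<Omega>)"
      by (intro borel_measurable_sum borel_measurable_integrable[OF L2_mult_integrable] L2_component
          H1_weak_grad(2) Xsp_component(2) u test_fun_L2(1) sq)
    show "AE x in lebesgue_on \<Omega>. (\<Sum>j\<in>UNIV. ?g j x * (\<psi> x * \<psi> x)) = 0"
      using u(2) by eventually_elim (simp add: dvg_def trace_def grad_def sum_distrib_right[symmetric])
  qed simp
  finally show ?thesis by simp
qed

text \<open>
  Apply the preceding lemma to each component of the field.
\<close>

lemma conv_test_field_skew:
  assumes u: "u \<in> Xsp \<Omega>" "AE x in lebesgue_on \<Omega>. dvg \<Omega> u x = 0"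
    and C: "\<And>x. x \<in> \<Omega> \<Longrightarrow> norm (u x) \<le> C"
    and \<Phi>: "\<And>i. (\<lambda>x. \<Phi> x $ i) \<in> test_fun \<Omega>"
  shows "ip \<Omega> (conv \<Omega> u \<Phi>) \<Phi> = 0"
proof -
  note \<Phi>X = test_field_Xsp[OF \<Phi>]
  have L: "conv \<Omega> u \<Phi> \<in> L2 \<Omega>" by (rule conv_L2[OF u(1) \<Phi>X C])
  have uL: "(\<lambda>x. u x $ j) \<in> L2 \<Omega>" for j by (rule L2_component[OF Xsp_L2[OF u(1)]])
  have b: "(\<lambda>x. partial j (\<lambda>x. \<Phi> x $ i) x * u x $ j) \<in> L2 \<Omega>" for i j
  proof (rule L2_bound[OF test_fun_L2(2)[OF \<Phi>]])
    show "(\<lambda>x. partial j (\<lambda>x. \<Phi> x $ i) x * u x $ j) \<in> borel_measurable (lebesgue_on \<Omega>)"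
      by (intro borel_measurable_times L2D(1)[OF test_fun_L2(2)[OF \<Phi>]] L2D(1)[OF uL])
    fix x assume "x \<in> \<Omega>"
    have "\<bar>u x $ j\<bar> \<le> C" using component_le_norm_cart[of "u x" j] C[OF \<open>x \<in> \<Omega>\<close>] by simp
    then have "\<bar>partial j (\<lambda>x. \<Phi> x $ i) x\<bar> * \<bar>u x $ j\<bar> \<le> \<bar>partial j (\<lambda>x. \<Phi> x $ i) x\<bar> * C"
      by (intro mult_left_mono) auto
    then show "norm (partial j (\<lambda>x. \<Phi> x $ i) x * u x $ j) \<le> C * norm (partial j (\<lambda>x. \<Phi> x $ i) x)"
      by (simp add: abs_mult mult.commute)
  qed
  have comp: "ip \<Omega> (\<lambda>x. conv \<Omega> u \<Phi> x $ i) (\<lambda>x. \<Phi> x $ i) = 0" for i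
  proof -
    have "AE x in lebesgue_on \<Omega>. conv \<Omega> u \<Phi> x $ i = (\<Sum>j\<in>UNIV. partial j (\<lambda>x. \<Phi> x $ i) x * u x $ j)"
      using weak_grad_test_fun(2)[OF \<Phi>, of i]
      by eventually_elim (simp add: conv_def grad_def matrix_vector_mult_def)
    then have "ip \<Omega> (\<lambda>x. conv \<Omega> u \<Phi> x $ i) (\<lambda>x. \<Phi> x $ i)
        = ip \<Omega> (\<lambda>x. \<Sum>j\<in>UNIV. partial j (\<lambda>x. \<Phi> x $ i) x * u x $ j) (\<lambda>x. \<Phi> x $ i)"
      by (rule ip_cong_AE[OF _ AE_I2[OF refl] L2_component[OF L] test_fun_L2(1)[OF \<Phi>]
            L2_sum[OF b] test_fun_L2(1)[OF \<Phi>]])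
    also have "\<dots> = (LINT x|lebesgue_on \<Omega>. (\<Sum>j\<in>UNIV. partial j (\<lambda>x. \<Phi> x $ i) x * u x $ j * \<Phi> x $ i))"
      by (simp add: ip_def sum_distrib_right)
    also have "\<dots> = (\<Sum>j\<in>UNIV. LINT x|lebesgue_on \<Omega>. partial j (\<lambda>x. \<Phi> x $ i) x * u x $ j * \<Phi> x $ i)"
      by (rule Bochner_Integration.integral_sum) (rule L2_mult_integrable[OF b test_fun_L2(1)[OF \<Phi>]])
    also have "\<dots> = 0" by (rule advection_test_fun_skew[OF u \<Phi>])
    finally show ?thesis .
  qed
  have "ip \<Omega> (conv \<Omega> u \<Phi>) \<Phi> = (\<Sum>i\<in>UNIV. ip \<Omega> (\<lambda>x. conv \<Omega> u \<Phi> x $ i) (\<lambda>x. \<Phi> x $ i))"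
    by (rule ip_vec[OF L2_component[OF L] test_fun_L2(1)[OF \<Phi>]])
  then show ?thesis by (simp add: comp)
qed

lemma Xsp_approx:
  assumes v: "v \<in> Xsp \<Omega>"
  obtains \<Phi> where "\<And>n i. (\<lambda>x. \<Phi> n x $ i) \<in> test_fun \<Omega>"
    "(\<lambda>n. nrm \<Omega> (grad \<Omega> (\<lambda>x. \<Phi> n x - v x))) \<longlonglongrightarrow> 0"
proof -
  have "\<forall>i. \<exists>\<phi>. (\<forall>n::nat. \<phi> n \<in> test_fun \<Omega>) \<and> (\<lambda>n. H1_norm \<Omega> (\<lambda>x. \<phi> n x - v x $ i)) \<longlonglongrightarrow> 0"
    using Xsp_component(1)[OF v] unfolding H1_0_def by blast
  from choice[OF this] obtain \<phi> where \<phi>: "\<And>i n. \<phi> i n \<in> test_fun \<Omega>"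
    "\<And>i. (\<lambda>n. H1_norm \<Omega> (\<lambda>x. \<phi> i n x - v x $ i)) \<longlonglongrightarrow> 0" by blast
  define \<Phi> where "\<Phi> n x = (\<chi> i. \<phi> i n x)" for n x
  have T: "(\<lambda>x. \<Phi> n x $ i) \<in> test_fun \<Omega>" for n i
    using \<phi>(1)[of i n] by (simp add: \<Phi>_def)
  let ?e = "\<lambda>n x. \<Phi> n x - v x"
  have e: "?e n \<in> Xsp \<Omega>" for n
    using Xsp_lincomb[OF test_field_Xsp[OF T] v, of 1 n "-1"] by simp
  let ?s = "\<lambda>n. \<Sum>i\<in>UNIV. (H1_norm \<Omega> (\<lambda>x. \<phi> i n x - v x $ i))\<^sup>2"
  have le: "nrm \<Omega> (grad \<Omega> (?e n)) \<le> sqrt (?s n)" for n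
  proof (rule real_le_rsqrt)
    have "(nrm \<Omega> (grad \<Omega> (?e n)))\<^sup>2 = (\<Sum>i\<in>UNIV. (nrm \<Omega> (weak_grad \<Omega> (\<lambda>x. ?e n x $ i)))\<^sup>2)"
      unfolding nrm_sq
      by (subst ip_vec) (simp_all add: grad_def H1_weak_grad(2)[OF Xsp_component(2)[OF e]]
          del: vector_minus_component)
    also have "\<dots> \<le> ?s n"
    proof (rule sum_mono)
      fix i
      have "(nrm \<Omega> (weak_grad \<Omega> (\<lambda>x. \<phi> i n x - v x $ i)))\<^sup>2 \<le> (H1_norm \<Omega> (\<lambda>x. \<phi> i n x - v x $ i))\<^sup>2"
        by (intro power_mono nrm_weak_grad_le_H1_norm nrm_nonneg)
      then show "(nrm \<Omega> (weak_grad \<Omega> (\<lambda>x. ?e n x $ i)))\<^sup>2 \<le> (H1_norm \<Omega> (\<lambda>x. \<phi> i n x - v x $ i))\<^sup>2"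
        by (simp add: \<Phi>_def)
    qed
    finally show "(nrm \<Omega> (grad \<Omega> (?e n)))\<^sup>2 \<le> ?s n" .
  qed
  have "(\<lambda>n. sqrt (?s n)) \<longlonglongrightarrow> sqrt (\<Sum>i\<in>(UNIV::'d set). 0\<^sup>2)"
    by (intro tendsto_real_sqrt tendsto_sum tendsto_power \<phi>(2))
  then have up: "(\<lambda>n. sqrt (?s n)) \<longlonglongrightarrow> 0" by simp
  have "(\<lambda>n. nrm \<Omega> (grad \<Omega> (?e n))) \<longlonglongrightarrow> 0"
    by (rule tendsto_sandwich[OF always_eventually always_eventually tendsto_const up])
      (intro allI nrm_nonneg, intro allI le)
  with T show ?thesis by (rule that)
qed

text \<open>
  For an approximation \<open>\<Phi> = v + e\<close> of \<open>v\<close> by test fields, expanding \<open>(u \<cdot> \<nabla>\<Phi>, \<Phi>) = 0\<close> expresses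
  \<open>(u \<cdot> \<nabla>v, v)\<close> by terms that contain \<open>e\<close>. The trilinear estimate, with \<open>\<nabla>u\<close> absorbed into the
  constant \<open>K\<close>, bounds them by multiples of \<open>\<parallel>\<nabla>e\<parallel>\<close>, which tends to zero.
\<close>

theorem conv_skew:
  assumes u: "u \<in> Xsp \<Omega>" "AE x in lebesgue_on \<Omega>. dvg \<Omega> u x = 0"
    and C: "\<And>x. x \<in> \<Omega> \<Longrightarrow> norm (u x) \<le> C"
    and tri: "\<And>b c. b \<in> Xsp \<Omega> \<Longrightarrow> c \<in> Xsp \<Omega> \<Longrightarrow>
        \<bar>ip \<Omega> (conv \<Omega> u b) c\<bar> \<le> K * nrm \<Omega> (grad \<Omega> b) * nrm \<Omega> (grad \<Omega> c)"
    and v: "v \<in> Xsp \<Omega>"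
  shows "ip \<Omega> (conv \<Omega> u v) v = 0"
proof -
  obtain \<Phi> where \<Phi>: "\<And>n i. (\<lambda>x. \<Phi> n x $ i) \<in> test_fun \<Omega>"
    and lim: "(\<lambda>n. nrm \<Omega> (grad \<Omega> (\<lambda>x. \<Phi> n x - v x))) \<longlonglongrightarrow> 0"
    using Xsp_approx[OF v] by blast
  let ?B = "\<lambda>b c. ip \<Omega> (conv \<Omega> u b) c"
  let ?e = "\<lambda>n x. \<Phi> n x - v x"
  have e: "?e n \<in> Xsp \<Omega>" for n
    using Xsp_lincomb[OF test_field_Xsp[OF \<Phi>] v, of 1 n "-1"] by simp
  have le: "\<bar>?B v v\<bar> \<le> 2 * (K * nrm \<Omega> (grad \<Omega> v)) * nrm \<Omega> (grad \<Omega> (?e n))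
      + K * nrm \<Omega> (grad \<Omega> (?e n)) * nrm \<Omega> (grad \<Omega> (?e n))" for n
  proof -
    have X: "\<Phi> n \<in> Xsp \<Omega>" by (rule test_field_Xsp[OF \<Phi>])
    have "(\<lambda>x. 1 *\<^sub>R v x + 1 *\<^sub>R ?e n x) = \<Phi> n" by simp
    then have "0 = ?B (\<lambda>x. 1 *\<^sub>R v x + 1 *\<^sub>R ?e n x) (\<lambda>x. 1 *\<^sub>R v x + 1 *\<^sub>R ?e n x)"
      using conv_test_field_skew[OF u C \<Phi>, of n] by simp
    also have "\<dots> = 1 * ?B v (\<lambda>x. 1 *\<^sub>R v x + 1 *\<^sub>R ?e n x) + 1 * ?B (?e n) (\<lambda>x. 1 *\<^sub>R v x + 1 *\<^sub>R ?e n x)"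
      by (rule ip_conv_lincomb_middle[OF u(1) C v e Xsp_lincomb[OF v e]])
    also have "\<dots> = 1 * (1 * ?B v v + 1 * ?B v (?e n)) + 1 * (1 * ?B (?e n) v + 1 * ?B (?e n) (?e n))"
      by (simp only: ip_lincomb_right[OF Xsp_L2[OF v] Xsp_L2[OF e] conv_L2[OF u(1) v C]]
          ip_lincomb_right[OF Xsp_L2[OF v] Xsp_L2[OF e] conv_L2[OF u(1) e C]])
    finally have "?B v v = - ?B v (?e n) - ?B (?e n) v - ?B (?e n) (?e n)" by simp
    then show ?thesis
      using tri[OF v e[of n]] tri[OF e[of n] v] tri[OF e[of n] e[of n]] by (simp add: mult.commute mult.left_commute)
  qed
  have "(\<lambda>n. 2 * (K * nrm \<Omega> (grad \<Omega> v)) * nrm \<Omega> (grad \<Omega> (?e n))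
      + K * nrm \<Omega> (grad \<Omega> (?e n)) * nrm \<Omega> (grad \<Omega> (?e n)))
      \<longlonglongrightarrow> 2 * (K * nrm \<Omega> (grad \<Omega> v)) * 0 + K * 0 * 0"
    by (intro tendsto_add tendsto_mult tendsto_const lim)
  then have "\<bar>?B v v\<bar> \<le> 2 * (K * nrm \<Omega> (grad \<Omega> v)) * 0 + K * 0 * 0"
    by (rule tendsto_lowerbound) (use le in auto)
  then show ?thesis by simp
qed

text \<open>
  The supremum in \<open>dual_norm\<close> gives the bound when \<open>\<nabla>\<phi>\<close> has positive norm; then \<open>\<phi>\<close> is nonzero, as
  the supremum requires. If the norm is zero, the continuity of \<open>F\<close> makes both sides vanish.
\<close>

lemma dual_norm_bound:
  assumes F: "F \<in> Hminus1 \<Omega>" and \<phi>: "\<phi> \<in> Xsp \<Omega>"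
  shows "F \<phi> \<le> dual_norm \<Omega> F * nrm \<Omega> (grad \<Omega> \<phi>)"
proof -
  obtain C where C: "\<And>\<phi>. \<phi> \<in> Xsp \<Omega> \<Longrightarrow> \<bar>F \<phi>\<bar> \<le> C * nrm \<Omega> (grad \<Omega> \<phi>)"
    using F unfolding Hminus1_def mem_Collect_eq by (elim conjE exE) (rule that, blast)
  show ?thesis
  proof (cases "nrm \<Omega> (grad \<Omega> \<phi>) = 0")
    case True
    then show ?thesis using C[OF \<phi>] by simp
  next
    case False
    then have pos: "0 < nrm \<Omega> (grad \<Omega> \<phi>)" using nrm_nonneg[of \<Omega> "grad \<Omega> \<phi>"] by simp
    have "nonzero_on \<Omega> \<phi>"
      unfolding nonzero_on_def
    proof
      assume z: "AE x in lebesgue_on \<Omega>. \<phi> x = 0"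
      have "AE x in lebesgue_on \<Omega>. weak_grad \<Omega> (\<lambda>x. \<phi> x $ i) x = 0" for i
        by (rule weak_grad_null[OF Xsp_component(2)[OF \<phi>]]) (use z in \<open>eventually_elim, simp\<close>)
      then have "AE x in lebesgue_on \<Omega>. \<forall>i. weak_grad \<Omega> (\<lambda>x. \<phi> x $ i) x = 0"
        by (simp add: AE_all_countable)
      then have "AE x in lebesgue_on \<Omega>. grad \<Omega> \<phi> x = 0"
        by eventually_elim (simp add: grad_def vec_eq_iff)
      from nrm_cong_AE[OF this grad_L2[OF \<phi>] L2_zero] False show False by (simp add: nrm_zero)
    qed
    have "F \<phi> / nrm \<Omega> (grad \<Omega> \<phi>) \<le> dual_norm \<Omega> F"
      unfolding dual_norm_def
    proof (rule cSUP_upper)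
      show "\<phi> \<in> {\<phi> \<in> Xsp \<Omega>. nonzero_on \<Omega> \<phi>}" using \<phi> \<open>nonzero_on \<Omega> \<phi>\<close> by simp
      \<comment> \<open>the \<open>0\<close> accounts for quotients with vanishing denominator\<close>
      have "F \<psi> / nrm \<Omega> (grad \<Omega> \<psi>) \<le> max C 0" if "\<psi> \<in> Xsp \<Omega>" for \<psi>
      proof (cases "nrm \<Omega> (grad \<Omega> \<psi>) = 0")
        case False
        then have "0 < nrm \<Omega> (grad \<Omega> \<psi>)" using nrm_nonneg[of \<Omega> "grad \<Omega> \<psi>"] by simp
        moreover have "F \<psi> \<le> C * nrm \<Omega> (grad \<Omega> \<psi>)" using C[OF that] by simp
        ultimately have "F \<psi> / nrm \<Omega> (grad \<Omega> \<psi>) \<le> C" by (simp add: pos_divide_le_eq)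
        then show ?thesis by simp
      qed simp
      then show "bdd_above ((\<lambda>\<phi>. F \<phi> / nrm \<Omega> (grad \<Omega> \<phi>)) ` {\<phi> \<in> Xsp \<Omega>. nonzero_on \<Omega> \<phi>})"
        by (intro bdd_aboveI2[of _ _ "max C 0"]) simp
    qed
    with pos show ?thesis by (simp add: pos_divide_le_eq)
  qed
qed

end

section \<open>The energy identity of BDF2\<close>

lemma ip_scale_left: "ip \<Omega> (\<lambda>x. r *\<^sub>R u x) w = r * ip \<Omega> u w"
  by (simp add: ip_def)

text \<open>
  The G-stability of BDF2: tested with the new value, the scheme gives the increment of
  \<open>\<parallel>u\<^sup>n\<parallel>\<^sup>2 + \<parallel>2u\<^sup>n - u\<^sup>n\<^sup>-\<^sup>1\<parallel>\<^sup>2\<close> plus the square of the second difference. The identity holds pointwise.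
\<close>

lemma bdf2_identity:
  assumes a: "a \<in> L2 \<Omega>" and b: "b \<in> L2 \<Omega>" and c: "c \<in> L2 \<Omega>"
  shows "2 * ip \<Omega> (\<lambda>x. 3 *\<^sub>R a x - 4 *\<^sub>R b x + c x) a
    = (nrm \<Omega> a)\<^sup>2 + (nrm \<Omega> (\<lambda>x. 2 *\<^sub>R a x - b x))\<^sup>2 - (nrm \<Omega> b)\<^sup>2
      - (nrm \<Omega> (\<lambda>x. 2 *\<^sub>R b x - c x))\<^sup>2 + (nrm \<Omega> (\<lambda>x. a x - 2 *\<^sub>R b x + c x))\<^sup>2"
proof -
  have ab: "(\<lambda>x. 2 *\<^sub>R a x - b x) \<in> L2 \<Omega>" and bc: "(\<lambda>x. 2 *\<^sub>R b x - c x) \<in> L2 \<Omega>"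
    and abc: "(\<lambda>x. a x - 2 *\<^sub>R b x + c x) \<in> L2 \<Omega>"
    by (intro L2_add L2_diff L2_scale a b c)+
  note I = L2_product_integrable[OF a a] L2_product_integrable[OF b b] L2_product_integrable[OF ab ab]
    L2_product_integrable[OF bc bc] L2_product_integrable[OF abc abc]
  have "2 * ip \<Omega> (\<lambda>x. 3 *\<^sub>R a x - 4 *\<^sub>R b x + c x) a
      = (LINT x|lebesgue_on \<Omega>. 2 * ((3 *\<^sub>R a x - 4 *\<^sub>R b x + c x) \<bullet> a x))"
    by (simp add: ip_def)
  also have "\<dots> = (LINT x|lebesgue_on \<Omega>. a x \<bullet> a x + (2 *\<^sub>R a x - b x) \<bullet> (2 *\<^sub>R a x - b x) - b x \<bullet> b x
      - (2 *\<^sub>R b x - c x) \<bullet> (2 *\<^sub>R b x - c x)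
      + (a x - 2 *\<^sub>R b x + c x) \<bullet> (a x - 2 *\<^sub>R b x + c x))"
    by (intro Bochner_Integration.integral_cong refl)
      (simp add: inner_simps inner_commute algebra_simps)
  also have "\<dots> = ip \<Omega> a a + ip \<Omega> (\<lambda>x. 2 *\<^sub>R a x - b x) (\<lambda>x. 2 *\<^sub>R a x - b x) - ip \<Omega> b b
      - ip \<Omega> (\<lambda>x. 2 *\<^sub>R b x - c x) (\<lambda>x. 2 *\<^sub>R b x - c x)
      + ip \<Omega> (\<lambda>x. a x - 2 *\<^sub>R b x + c x) (\<lambda>x. a x - 2 *\<^sub>R b x + c x)"
    unfolding ip_def using I
    by (simp only: Bochner_Integration.integral_add Bochner_Integration.integral_diff
        Bochner_Integration.integrable_add Bochner_Integration.integrable_diff)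
  finally show ?thesis by (simp only: nrm_sq)
qed

text \<open>
  The weight \<open>\<alpha> / 12\<close> is a third of the \<open>\<alpha> / 4\<close> that the three terms estimated in this way may use.
\<close>

lemma young_weighted:
  fixes x y \<alpha> :: real
  assumes "\<alpha> > 0"
  shows "x * y \<le> \<alpha> / 12 * x\<^sup>2 + 3 / \<alpha> * y\<^sup>2"
proof -
  have "\<alpha> / 12 * x\<^sup>2 + 3 / \<alpha> * y\<^sup>2 - x * y = (\<alpha> * x - 6 * y)\<^sup>2 / (12 * \<alpha>)"
    using assms by (simp add: field_simps power2_eq_square)
  also have "\<dots> \<ge> 0" using assms by simp
  finally show ?thesis by simp
qed

section \<open>Energy estimate of one time step\<close>

definition second_diff :: "'d::finite family \<Rightarrow> nat \<Rightarrow> nat \<Rightarrow> real^'d \<Rightarrow> real^'d" where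
  "second_diff u j n x = u j (n + 1) x - 2 *\<^sub>R u j n x + u j (n - 1) x"

context bounded_open begin

text \<open>
  The fields for which \<open>conv_skew\<close> is available. The class is linear, so it contains ensemble means and
  fluctuations together with the members of the ensemble.
\<close>

definition advecting :: "(real^'d \<Rightarrow> real^'d) set" where
  "advecting = {u \<in> Xsp \<Omega>. (\<exists>C. \<forall>x\<in>\<Omega>. norm (u x) \<le> C) \<and> (AE x in lebesgue_on \<Omega>. dvg \<Omega> u x = 0)}"

lemma advecting_lincomb:
  assumes "u \<in> advecting" "v \<in> advecting"
  shows "(\<lambda>x. a *\<^sub>R u x + b *\<^sub>R v x) \<in> advecting"
proof -
  obtain C D where C: "\<And>x. x \<in> \<Omega> \<Longrightarrow> norm (u x) \<le> C" and D: "\<And>x. x \<in> \<Omega> \<Longrightarrow> norm (v x) \<le> D"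
    using assms unfolding advecting_def by auto
  have "norm (a *\<^sub>R u x + b *\<^sub>R v x) \<le> \<bar>a\<bar> * C + \<bar>b\<bar> * D" if "x \<in> \<Omega>" for x
    using C[OF that] D[OF that]
    by (intro norm_triangle_le add_mono) (auto intro: mult_left_mono)
  moreover have "(\<lambda>x. a *\<^sub>R u x + b *\<^sub>R v x) \<in> Xsp \<Omega>"
    using assms by (intro Xsp_lincomb) (auto simp: advecting_def)
  moreover have "AE x in lebesgue_on \<Omega>. dvg \<Omega> (\<lambda>x. a *\<^sub>R u x + b *\<^sub>R v x) x = 0"
    using assms by (intro dvg_lincomb_null) (auto simp: advecting_def)
  ultimately show ?thesis unfolding advecting_def by blast
qed

lemma advecting_sum:
  assumes "finite I" "I \<noteq> {}" "\<And>i. i \<in> I \<Longrightarrow> u i \<in> advecting"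
  shows "(\<lambda>x. \<Sum>i\<in>I. u i x) \<in> advecting"
  using assms
proof (induction I rule: finite_ne_induct)
  case (insert i I)
  then have "(\<lambda>x. 1 *\<^sub>R u i x + 1 *\<^sub>R (\<Sum>i\<in>I. u i x)) \<in> advecting"
    by (intro advecting_lincomb) auto
  with insert show ?case by simp
qed simp

lemma ens_mean_advecting:
  assumes "J \<ge> 1" "\<And>j. j \<in> {1..J} \<Longrightarrow> b j n \<in> advecting \<and> b j (n - 1) \<in> advecting"
  shows "ens_mean J b n \<in> advecting"
proof -
  have "(\<lambda>x. 2 *\<^sub>R b j n x + (-1) *\<^sub>R b j (n - 1) x) \<in> advecting" if "j \<in> {1..J}" for j
    using assms(2)[OF that] by (intro advecting_lincomb) auto
  then have "(\<lambda>x. 2 *\<^sub>R b j n x - b j (n - 1) x) \<in> advecting" if "j \<in> {1..J}" for j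
    using that by simp
  then have s: "(\<lambda>x. \<Sum>j=1..J. 2 *\<^sub>R b j n x - b j (n - 1) x) \<in> advecting"
    using assms(1) by (intro advecting_sum) auto
  from advecting_lincomb[OF s s, of "1 / real J" 0] show ?thesis
    by (simp add: ens_mean_def[abs_def])
qed

lemma fluct_advecting:
  assumes "J \<ge> 1" "\<And>j. j \<in> {1..J} \<Longrightarrow> b j n \<in> advecting \<and> b j (n - 1) \<in> advecting" "j \<in> {1..J}"
  shows "fluct J b j n \<in> advecting"
proof -
  have e: "(\<lambda>x. 2 *\<^sub>R b j n x + (-1) *\<^sub>R b j (n - 1) x) \<in> advecting"
    using assms(2)[OF assms(3)] by (intro advecting_lincomb) auto
  have m: "ens_mean J b n \<in> advecting"
    by (rule ens_mean_advecting[OF assms(1)]) (rule assms(2))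
  from advecting_lincomb[OF e m, of 1 "-1"] show ?thesis
    by (simp add: fluct_def[abs_def])
qed

lemma conv_skew_advecting:
  assumes tri: "\<And>a b c. a \<in> Xsp \<Omega> \<Longrightarrow> b \<in> Xsp \<Omega> \<Longrightarrow> c \<in> Xsp \<Omega> \<Longrightarrow>
        \<bar>ip \<Omega> (conv \<Omega> a b) c\<bar> \<le> Cs * nrm \<Omega> (grad \<Omega> a) * nrm \<Omega> (grad \<Omega> b) * nrm \<Omega> (grad \<Omega> c)"
    and u: "u \<in> advecting" and v: "v \<in> Xsp \<Omega>"
  shows "ip \<Omega> (conv \<Omega> u v) v = 0"
proof -
  obtain C where u': "u \<in> Xsp \<Omega>" "AE x in lebesgue_on \<Omega>. dvg \<Omega> u x = 0"
    and C: "\<And>x. x \<in> \<Omega> \<Longrightarrow> norm (u x) \<le> C"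
    using u unfolding advecting_def by blast
  show ?thesis by (rule conv_skew[OF u' C tri[OF u'(1)] v])
qed

text \<open>
  One equation tested with its unknown. The difference of the gradients of the new value and of
  the second difference replaces the extrapolated gradient. The forcing, the viscous coupling to the
  second difference of \<open>b\<close>, and the convection of the second difference of \<open>a\<close> each cost
  \<open>\<alpha> / 12 * P\<^sup>2\<close>, which together make up the \<open>\<alpha> / 4\<close> in the coefficient of \<open>P\<^sup>2\<close>. The two terms with
  \<open>\<bar>\<nu> - \<nu>\<^sub>m\<bar> / 4\<close> come from the coupling of the new values. The factor \<open>4 * \<Delta>t\<close> clears
  the denominator of the BDF2 difference and the factor 2 in \<open>bdf2_identity\<close>.
\<close>

lemma one_equation_energy:
  fixes a b :: "'d family" and f :: "nat \<Rightarrow> real \<Rightarrow> (real^'d \<Rightarrow> real^'d) \<Rightarrow> real"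
    and \<nu> \<nu>\<^sub>m \<alpha> \<Delta>t Cs W :: real and j n :: nat
  defines "P \<equiv> nrm \<Omega> (grad \<Omega> (a j (n + 1)))" and "Q \<equiv> nrm \<Omega> (grad \<Omega> (b j (n + 1)))"
    and "DA \<equiv> nrm \<Omega> (grad \<Omega> (second_diff a j n))" and "DB \<equiv> nrm \<Omega> (grad \<Omega> (second_diff b j n))"
    and "d \<equiv> dual_norm \<Omega> (f j (real (n + 1) * \<Delta>t))"
  assumes \<alpha>: "\<alpha> > 0" and \<Delta>t: "\<Delta>t > 0"
    and tri: "\<And>a b c. a \<in> Xsp \<Omega> \<Longrightarrow> b \<in> Xsp \<Omega> \<Longrightarrow> c \<in> Xsp \<Omega> \<Longrightarrow>
        \<bar>ip \<Omega> (conv \<Omega> a b) c\<bar> \<le> Cs * nrm \<Omega> (grad \<Omega> a) * nrm \<Omega> (grad \<Omega> b) * nrm \<Omega> (grad \<Omega> c)"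
    and step: "step_eq \<Omega> Vh J \<Delta>t \<nu> \<nu>\<^sub>m f a b j n" and test: "a j (n + 1) \<in> Vh"
    and A: "a j (n + 1) \<in> Xsp \<Omega>" "a j n \<in> Xsp \<Omega>" "a j (n - 1) \<in> Xsp \<Omega>"
    and B: "b j (n + 1) \<in> Xsp \<Omega>" "b j n \<in> Xsp \<Omega>" "b j (n - 1) \<in> Xsp \<Omega>"
    and mean: "ens_mean J b n \<in> advecting" and fl: "fluct J b j n \<in> advecting"
    and F: "f j (real (n + 1) * \<Delta>t) \<in> Hminus1 \<Omega>"
    and W: "(nrm \<Omega> (grad \<Omega> (fluct J b j n)))\<^sup>2 \<le> W"
  shows "2 * ip \<Omega> (\<lambda>x. 3 *\<^sub>R a j (n + 1) x - 4 *\<^sub>R a j n x + a j (n - 1) x) (a j (n + 1))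
    \<le> 4 * \<Delta>t * (- ((\<nu> + \<nu>\<^sub>m) / 2 - \<alpha> / 4 - \<bar>\<nu> - \<nu>\<^sub>m\<bar> / 4) * P\<^sup>2 + \<bar>\<nu> - \<nu>\<^sub>m\<bar> / 4 * Q\<^sup>2
        + 3 / \<alpha> * (d\<^sup>2 + (\<nu> - \<nu>\<^sub>m)\<^sup>2 / 4 * DB\<^sup>2 + Cs\<^sup>2 * W * DA\<^sup>2))"
proof -
  define p where "p = a j (n + 1)"
  define q where "q = b j (n + 1)"
  define T where "T = ip \<Omega> (\<lambda>x. 3 *\<^sub>R a j (n + 1) x - 4 *\<^sub>R a j n x + a j (n - 1) x) p"
  let ?m = "ens_mean J b n" and ?fl = "fluct J b j n"
  let ?da = "second_diff a j n" and ?db = "second_diff b j n"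
  have pX: "p \<in> Xsp \<Omega>" and qX: "q \<in> Xsp \<Omega>" using A B by (simp_all add: p_def q_def)
  have sd: "second_diff u j n \<in> Xsp \<Omega>"
    if "u j (n + 1) \<in> Xsp \<Omega>" "u j n \<in> Xsp \<Omega>" "u j (n - 1) \<in> Xsp \<Omega>" for u
    using Xsp_lincomb[OF Xsp_lincomb[OF that(1,2), of 1 "-2"] that(3), of 1 1]
    by (simp add: second_diff_def[abs_def])
  note daX = sd[of a, OF A] and dbX = sd[of b, OF B]
  have ex: "extrap u j n = (\<lambda>x. 1 *\<^sub>R u j (n + 1) x + (-1) *\<^sub>R second_diff u j n x)" for u
    by (simp add: fun_eq_iff extrap_def second_diff_def)
  obtain C where flX: "?fl \<in> Xsp \<Omega>" and C: "\<And>x. x \<in> \<Omega> \<Longrightarrow> norm (?fl x) \<le> C"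
    using fl unfolding advecting_def by blast
  have eq: "T / (2 * \<Delta>t) + (\<nu> + \<nu>\<^sub>m) / 2 * P\<^sup>2
      + (\<nu> - \<nu>\<^sub>m) / 2 * (ip \<Omega> (grad \<Omega> q) (grad \<Omega> p) - ip \<Omega> (grad \<Omega> ?db) (grad \<Omega> p))
      - ip \<Omega> (conv \<Omega> ?fl ?da) p = f j (real (n + 1) * \<Delta>t) p"
  proof -
    have "ip \<Omega> (BDF2 \<Delta>t a j n) p = T / (2 * \<Delta>t)"
      unfolding BDF2_def[abs_def] ip_scale_left by (simp add: T_def)
    moreover have "ip \<Omega> (grad \<Omega> p) (grad \<Omega> p) = P\<^sup>2"
      by (simp add: P_def p_def nrm_sq)
    moreover have "ip \<Omega> (grad \<Omega> (extrap b j n)) (grad \<Omega> p)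
        = ip \<Omega> (grad \<Omega> q) (grad \<Omega> p) - ip \<Omega> (grad \<Omega> ?db) (grad \<Omega> p)"
      unfolding ex[of b] q_def[symmetric] using ip_grad_lincomb_left[OF qX dbX pX, of 1 "-1"] by simp
    moreover have "ip \<Omega> (conv \<Omega> ?m p) p = 0"
      by (rule conv_skew_advecting[OF tri mean pX])
    moreover have "ip \<Omega> (conv \<Omega> ?fl (extrap a j n)) p = - ip \<Omega> (conv \<Omega> ?fl ?da) p"
      unfolding ex[of a] p_def[symmetric]
      using ip_conv_lincomb_middle[OF flX C pX daX pX, of 1 "-1"] conv_skew_advecting[OF tri fl pX]
      by simp
    ultimately show ?thesis
      using step[unfolded step_eq_def, rule_format, OF test, folded p_def] by simp
  qed
  have "f j (real (n + 1) * \<Delta>t) p \<le> P * d"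
    using dual_norm_bound[OF F pX] by (simp add: P_def d_def p_def mult.commute)
  also have "\<dots> \<le> \<alpha> / 12 * P\<^sup>2 + 3 / \<alpha> * d\<^sup>2" by (rule young_weighted[OF \<alpha>])
  finally have 1: "f j (real (n + 1) * \<Delta>t) p \<le> \<alpha> / 12 * P\<^sup>2 + 3 / \<alpha> * d\<^sup>2" .
  have 2: "- ((\<nu> - \<nu>\<^sub>m) / 2 * ip \<Omega> (grad \<Omega> q) (grad \<Omega> p)) \<le> \<bar>\<nu> - \<nu>\<^sub>m\<bar> / 4 * P\<^sup>2 + \<bar>\<nu> - \<nu>\<^sub>m\<bar> / 4 * Q\<^sup>2"
  proof -
    have "- ((\<nu> - \<nu>\<^sub>m) / 2 * ip \<Omega> (grad \<Omega> q) (grad \<Omega> p)) \<le> \<bar>\<nu> - \<nu>\<^sub>m\<bar> / 2 * \<bar>ip \<Omega> (grad \<Omega> q) (grad \<Omega> p)\<bar>"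
      by (rule order_trans[OF abs_ge_minus_self]) (simp add: abs_mult)
    also have "\<dots> \<le> \<bar>\<nu> - \<nu>\<^sub>m\<bar> / 2 * ((P\<^sup>2 + Q\<^sup>2) / 2)"
    proof (rule mult_left_mono)
      have "\<bar>ip \<Omega> (grad \<Omega> q) (grad \<Omega> p)\<bar> \<le> Q * P"
        using ip_le_nrm_mult[OF grad_L2[OF qX] grad_L2[OF pX]] by (simp add: P_def Q_def p_def q_def)
      then show "\<bar>ip \<Omega> (grad \<Omega> q) (grad \<Omega> p)\<bar> \<le> (P\<^sup>2 + Q\<^sup>2) / 2"
        using sum_squares_bound[of Q P] by simp
    qed simp
    finally show ?thesis by (simp add: field_simps)
  qed
  have 3: "(\<nu> - \<nu>\<^sub>m) / 2 * ip \<Omega> (grad \<Omega> ?db) (grad \<Omega> p)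
      \<le> \<alpha> / 12 * P\<^sup>2 + 3 / \<alpha> * ((\<nu> - \<nu>\<^sub>m)\<^sup>2 / 4 * DB\<^sup>2)"
  proof -
    have "(\<nu> - \<nu>\<^sub>m) / 2 * ip \<Omega> (grad \<Omega> ?db) (grad \<Omega> p) \<le> \<bar>\<nu> - \<nu>\<^sub>m\<bar> / 2 * \<bar>ip \<Omega> (grad \<Omega> ?db) (grad \<Omega> p)\<bar>"
      by (rule order_trans[OF abs_ge_self]) (simp add: abs_mult)
    also have "\<dots> \<le> \<bar>\<nu> - \<nu>\<^sub>m\<bar> / 2 * (DB * P)"
      using ip_le_nrm_mult[OF grad_L2[OF dbX] grad_L2[OF pX]]
      by (intro mult_left_mono) (simp_all add: P_def DB_def p_def)
    also have "\<dots> = P * (\<bar>\<nu> - \<nu>\<^sub>m\<bar> / 2 * DB)" by simp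
    also have "\<dots> \<le> \<alpha> / 12 * P\<^sup>2 + 3 / \<alpha> * (\<bar>\<nu> - \<nu>\<^sub>m\<bar> / 2 * DB)\<^sup>2" by (rule young_weighted[OF \<alpha>])
    finally show ?thesis by (simp add: power_mult_distrib power_divide)
  qed
  have 4: "ip \<Omega> (conv \<Omega> ?fl ?da) p \<le> \<alpha> / 12 * P\<^sup>2 + 3 / \<alpha> * (Cs\<^sup>2 * W * DA\<^sup>2)"
  proof -
    have "ip \<Omega> (conv \<Omega> ?fl ?da) p \<le> P * (Cs * nrm \<Omega> (grad \<Omega> ?fl) * DA)"
      using tri[OF flX daX pX] by (simp add: P_def DA_def p_def mult.commute)
    also have "\<dots> \<le> \<alpha> / 12 * P\<^sup>2 + 3 / \<alpha> * (Cs * nrm \<Omega> (grad \<Omega> ?fl) * DA)\<^sup>2"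
      by (rule young_weighted[OF \<alpha>])
    also have "\<dots> \<le> \<alpha> / 12 * P\<^sup>2 + 3 / \<alpha> * (Cs\<^sup>2 * W * DA\<^sup>2)"
      unfolding power_mult_distrib
      by (intro add_left_mono mult_left_mono mult_right_mono W) (use \<alpha> in auto)
    finally show ?thesis .
  qed
  have "T / (2 * \<Delta>t) \<le> - ((\<nu> + \<nu>\<^sub>m) / 2 - \<alpha> / 4 - \<bar>\<nu> - \<nu>\<^sub>m\<bar> / 4) * P\<^sup>2 + \<bar>\<nu> - \<nu>\<^sub>m\<bar> / 4 * Q\<^sup>2
        + 3 / \<alpha> * (d\<^sup>2 + (\<nu> - \<nu>\<^sub>m)\<^sup>2 / 4 * DB\<^sup>2 + Cs\<^sup>2 * W * DA\<^sup>2)"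
  proof -
    have "(\<nu> - \<nu>\<^sub>m) / 2 * (ip \<Omega> (grad \<Omega> q) (grad \<Omega> p) - ip \<Omega> (grad \<Omega> ?db) (grad \<Omega> p))
        = (\<nu> - \<nu>\<^sub>m) / 2 * ip \<Omega> (grad \<Omega> q) (grad \<Omega> p) - (\<nu> - \<nu>\<^sub>m) / 2 * ip \<Omega> (grad \<Omega> ?db) (grad \<Omega> p)"
      by (rule right_diff_distrib)
    moreover have "- ((\<nu> + \<nu>\<^sub>m) / 2 - \<alpha> / 4 - \<bar>\<nu> - \<nu>\<^sub>m\<bar> / 4) * P\<^sup>2
        = - ((\<nu> + \<nu>\<^sub>m) / 2 * P\<^sup>2) + 3 * (\<alpha> / 12 * P\<^sup>2) + \<bar>\<nu> - \<nu>\<^sub>m\<bar> / 4 * P\<^sup>2"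
      by (simp add: algebra_simps)
    moreover have "3 / \<alpha> * (d\<^sup>2 + (\<nu> - \<nu>\<^sub>m)\<^sup>2 / 4 * DB\<^sup>2 + Cs\<^sup>2 * W * DA\<^sup>2)
        = 3 / \<alpha> * d\<^sup>2 + 3 / \<alpha> * ((\<nu> - \<nu>\<^sub>m)\<^sup>2 / 4 * DB\<^sup>2) + 3 / \<alpha> * (Cs\<^sup>2 * W * DA\<^sup>2)"
      by (simp only: distrib_left)
    ultimately show ?thesis using eq 1 2 3 4 by linarith
  qed
  then have "4 * \<Delta>t * (T / (2 * \<Delta>t)) \<le> 4 * \<Delta>t * (- ((\<nu> + \<nu>\<^sub>m) / 2 - \<alpha> / 4 - \<bar>\<nu> - \<nu>\<^sub>m\<bar> / 4) * P\<^sup>2 + \<bar>\<nu> - \<nu>\<^sub>m\<bar> / 4 * Q\<^sup>2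
        + 3 / \<alpha> * (d\<^sup>2 + (\<nu> - \<nu>\<^sub>m)\<^sup>2 / 4 * DB\<^sup>2 + Cs\<^sup>2 * W * DA\<^sup>2))"
    using \<Delta>t by (intro mult_left_mono) auto
  moreover have "4 * \<Delta>t * (T / (2 * \<Delta>t)) = 2 * T" using \<Delta>t by simp
  ultimately show ?thesis by (simp add: T_def p_def)
qed

end

text \<open>
  The inverse inequality costs a factor \<open>Ci\<^sup>2 / h\<^sup>2\<close>, which the restriction on the time step cancels.
  With a nonzero denominator, the restriction also forces \<open>h \<noteq> 0\<close>, because \<open>\<Delta>t\<close> is positive.
\<close>

lemma time_step_absorbs:
  fixes \<Delta>t \<alpha> S Ci h D N :: real
  assumes "\<alpha> > 0" "\<Delta>t > 0" "S \<ge> 0" "0 \<le> D"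
    and inv: "D \<le> Ci * inverse h * N"
    and cfl: "S * Ci\<^sup>2 \<noteq> 0 \<Longrightarrow> \<Delta>t \<le> \<alpha> * h\<^sup>2 / (S * Ci\<^sup>2)"
  shows "\<Delta>t / \<alpha> * S * D\<^sup>2 \<le> N\<^sup>2"
proof (cases "S * Ci\<^sup>2 = 0")
  case True
  then have "S * D\<^sup>2 = 0" using inv \<open>0 \<le> D\<close> by auto
  then show ?thesis by auto
next
  case False
  have pos: "S * Ci\<^sup>2 > 0" using False \<open>S \<ge> 0\<close> by (simp add: less_le)
  have "\<Delta>t * (S * Ci\<^sup>2) \<le> \<alpha> * h\<^sup>2"
    using cfl[OF False] pos by (simp add: pos_le_divide_eq)
  then have le: "\<Delta>t / \<alpha> * (S * Ci\<^sup>2) \<le> h\<^sup>2" using \<open>\<alpha> > 0\<close> by (simp add: field_simps)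
  have "h \<noteq> 0"
  proof
    assume "h = 0"
    with cfl[OF False] \<open>\<Delta>t > 0\<close> show False by simp
  qed
  have "D\<^sup>2 \<le> (Ci * inverse h * N)\<^sup>2" by (rule power_mono[OF inv \<open>0 \<le> D\<close>])
  then have "\<Delta>t / \<alpha> * S * D\<^sup>2 \<le> \<Delta>t / \<alpha> * S * (Ci * inverse h * N)\<^sup>2"
    by (rule mult_left_mono) (use assms in auto)
  also have "\<dots> = \<Delta>t / \<alpha> * (S * Ci\<^sup>2) * ((inverse h)\<^sup>2 * N\<^sup>2)" by (simp add: power_mult_distrib)
  also have "\<dots> \<le> h\<^sup>2 * ((inverse h)\<^sup>2 * N\<^sup>2)" by (rule mult_right_mono[OF le]) simp
  also have "\<dots> = N\<^sup>2" using \<open>h \<noteq> 0\<close> by (simp add: field_simps)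
  finally show ?thesis .
qed

text \<open>
  In the sum of the two equations the coefficient of \<open>P\<^sup>2\<close> and of \<open>Q\<^sup>2\<close> is
  \<open>(\<nu> + \<nu>\<^sub>m) / 2 - \<bar>\<nu> - \<nu>\<^sub>m\<bar> / 2 - \<alpha> / 4 = \<alpha> / 4\<close>, and multiplication by \<open>4 * \<Delta>t\<close> turns it into \<open>\<alpha> * \<Delta>t\<close>.
\<close>

lemma add_equation_energies:
  fixes TV TW P Q DV DW dv dw W NV NW \<alpha> \<Delta>t \<nu> \<nu>\<^sub>m Cs :: real
  assumes \<alpha>: "\<alpha> = \<nu> + \<nu>\<^sub>m - \<bar>\<nu> - \<nu>\<^sub>m\<bar>" "\<alpha> > 0"
    and V: "TV \<le> 4 * \<Delta>t * (- ((\<nu> + \<nu>\<^sub>m) / 2 - \<alpha> / 4 - \<bar>\<nu> - \<nu>\<^sub>m\<bar> / 4) * P\<^sup>2 + \<bar>\<nu> - \<nu>\<^sub>m\<bar> / 4 * Q\<^sup>2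
        + 3 / \<alpha> * (dv\<^sup>2 + (\<nu> - \<nu>\<^sub>m)\<^sup>2 / 4 * DW\<^sup>2 + Cs\<^sup>2 * W * DV\<^sup>2))"
    and W: "TW \<le> 4 * \<Delta>t * (- ((\<nu> + \<nu>\<^sub>m) / 2 - \<alpha> / 4 - \<bar>\<nu> - \<nu>\<^sub>m\<bar> / 4) * Q\<^sup>2 + \<bar>\<nu> - \<nu>\<^sub>m\<bar> / 4 * P\<^sup>2
        + 3 / \<alpha> * (dw\<^sup>2 + (\<nu> - \<nu>\<^sub>m)\<^sup>2 / 4 * DV\<^sup>2 + Cs\<^sup>2 * W * DW\<^sup>2))"
    and NV: "\<Delta>t / \<alpha> * (3 * (\<nu> - \<nu>\<^sub>m)\<^sup>2 + 12 * Cs\<^sup>2 * W) * DV\<^sup>2 \<le> NV"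
    and NW: "\<Delta>t / \<alpha> * (3 * (\<nu> - \<nu>\<^sub>m)\<^sup>2 + 12 * Cs\<^sup>2 * W) * DW\<^sup>2 \<le> NW"
  shows "TV + TW + \<alpha> * \<Delta>t * (P\<^sup>2 + Q\<^sup>2) \<le> NV + NW + 12 * \<Delta>t / \<alpha> * (dv\<^sup>2 + dw\<^sup>2)"
proof -
  define g where "g = \<bar>\<nu> - \<nu>\<^sub>m\<bar>"
  have G: "(\<nu> + \<nu>\<^sub>m) / 2 - \<alpha> / 4 - g / 4 = \<alpha> / 4 + g / 4"
    using \<alpha>(1) by (simp add: g_def field_simps)
  define c where "c = \<Delta>t / \<alpha>"
  define r where "r = (\<nu> - \<nu>\<^sub>m)\<^sup>2"
  define s where "s = Cs\<^sup>2 * W"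
  have c3: "4 * \<Delta>t * (3 / \<alpha> * z) = 12 * (c * z)" for z by (simp add: c_def)
  have V': "TV \<le> 4 * \<Delta>t * (- (\<alpha> / 4 + g / 4) * P\<^sup>2 + g / 4 * Q\<^sup>2)
      + 12 * (c * (dv\<^sup>2 + r / 4 * DW\<^sup>2 + s * DV\<^sup>2))"
    using V unfolding g_def[symmetric] r_def[symmetric] s_def[symmetric] G
    by (simp only: distrib_left[of "4 * \<Delta>t"] c3)
  have W': "TW \<le> 4 * \<Delta>t * (- (\<alpha> / 4 + g / 4) * Q\<^sup>2 + g / 4 * P\<^sup>2)
      + 12 * (c * (dw\<^sup>2 + r / 4 * DV\<^sup>2 + s * DW\<^sup>2))"
    using W unfolding g_def[symmetric] r_def[symmetric] s_def[symmetric] G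
    by (simp only: distrib_left[of "4 * \<Delta>t"] c3)
  have "TV + TW + \<alpha> * \<Delta>t * (P\<^sup>2 + Q\<^sup>2)
      \<le> c * (3 * r + 12 * s) * DV\<^sup>2 + c * (3 * r + 12 * s) * DW\<^sup>2 + 12 * (c * (dv\<^sup>2 + dw\<^sup>2))"
    using add_mono[OF V' W'] by (simp add: algebra_simps)
  also have "\<dots> \<le> NV + NW + 12 * (c * (dv\<^sup>2 + dw\<^sup>2))"
    using NV NW by (simp add: c_def r_def s_def mult.assoc)
  finally show ?thesis by (simp add: c_def)
qed

section \<open>The finite element space\<close>

lemma poly_le_lincomb:
  assumes "p \<in> poly_le k" "q \<in> poly_le k"
  shows "(\<lambda>x. a * p x + b * q x) \<in> poly_le k"
proof -
  obtain c d where
    "\<And>x. p x = (\<Sum>m | sum m UNIV \<le> k. c m * (\<Prod>i\<in>UNIV. (x $ i) ^ (m i)))"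
    "\<And>x. q x = (\<Sum>m | sum m UNIV \<le> k. d m * (\<Prod>i\<in>UNIV. (x $ i) ^ (m i)))"
    using assms unfolding poly_le_def by blast
  then have "a * p x + b * q x
      = (\<Sum>m | sum m UNIV \<le> k. (a * c m + b * d m) * (\<Prod>i\<in>UNIV. (x $ i) ^ (m i)))" for x
    by (simp add: sum_distrib_left sum.distrib[symmetric] algebra_simps)
  then show ?thesis
    unfolding poly_le_def mem_Collect_eq by (intro exI[of _ "\<lambda>m. a * c m + b * d m"]) blast
qed

lemma (in bounded_open) velocity_space_lincomb:
  assumes "u \<in> velocity_space \<Omega> \<T> k" "v \<in> velocity_space \<Omega> \<T> k"
  shows "(\<lambda>x. a *\<^sub>R u x + b *\<^sub>R v x) \<in> velocity_space \<Omega> \<T> k"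
proof -
  have "\<exists>p\<in>poly_le k. \<forall>x\<in>K. (a *\<^sub>R u x + b *\<^sub>R v x) $ i = p x" if "K \<in> \<T>" for K i
  proof -
    have "\<exists>p\<in>poly_le k. \<forall>x\<in>K. u x $ i = p x" "\<exists>q\<in>poly_le k. \<forall>x\<in>K. v x $ i = q x"
      using assms that by (simp_all add: velocity_space_def)
    then obtain p q where pq: "p \<in> poly_le k" "q \<in> poly_le k"
      and "\<forall>x\<in>K. u x $ i = p x" "\<forall>x\<in>K. v x $ i = q x" by blast
    then have "\<forall>x\<in>K. (a *\<^sub>R u x + b *\<^sub>R v x) $ i = a * p x + b * q x" by simp
    then show ?thesis by (rule bexI[OF _ poly_le_lincomb[OF pq]])
  qed
  moreover have "continuous_on (closure \<Omega>) (\<lambda>x. a *\<^sub>R u x + b *\<^sub>R v x)"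
    using assms unfolding velocity_space_def by (intro continuous_intros) auto
  moreover have "(\<lambda>x. a *\<^sub>R u x + b *\<^sub>R v x) \<in> Xsp \<Omega>"
    using assms unfolding velocity_space_def by (intro Xsp_lincomb) auto
  ultimately show ?thesis unfolding velocity_space_def mem_Collect_eq by (intro conjI ballI allI)
qed

lemma (in bounded_open) velocity_space_advecting:
  assumes u: "u \<in> velocity_space \<Omega> \<T> k" and d: "AE x in lebesgue_on \<Omega>. dvg \<Omega> u x = 0"
  shows "u \<in> advecting"
proof -
  have "continuous_on (closure \<Omega>) u" using u unfolding velocity_space_def by blast
  moreover have "compact (closure \<Omega>)" using bounded_\<Omega> by (simp add: compact_closure)
  ultimately have "bounded (u ` closure \<Omega>)"
    by (intro compact_imp_bounded compact_continuous_image)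
  then obtain C where "\<And>x. x \<in> closure \<Omega> \<Longrightarrow> norm (u x) \<le> C" by (auto simp: bounded_iff)
  then have "\<forall>x\<in>\<Omega>. norm (u x) \<le> C" using closure_subset[of \<Omega>] by blast
  then show ?thesis using u d unfolding advecting_def velocity_space_def by blast
qed

text \<open>
  The inverse inequality is available only in the finite element space, so the second differences
  must belong to it.
\<close>

lemma (in bounded_open) velocity_space_second_diff:
  assumes "u j (n + 1) \<in> velocity_space \<Omega> \<T> k" "u j n \<in> velocity_space \<Omega> \<T> k"
    "u j (n - 1) \<in> velocity_space \<Omega> \<T> k"
  shows "second_diff u j n \<in> velocity_space \<Omega> \<T> k"
  using velocity_space_lincomb[OF velocity_space_lincomb[OF assms(1,2), of 1 "-2"] assms(3), of 1 1]
  by (simp add: second_diff_def[abs_def])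

section \<open>Stability\<close>

theorem lemma3p1:
  fixes \<Omega> :: "(real^'d) set" and \<T> :: "(real^'d) set set"
    and Xh Vh :: "(real^'d \<Rightarrow> real^'d) set" and Qh :: "(real^'d \<Rightarrow> real) set"
    and v w :: "nat \<Rightarrow> nat \<Rightarrow> real^'d \<Rightarrow> real^'d"
    and f\<^sub>1 f\<^sub>2 :: "nat \<Rightarrow> real \<Rightarrow> (real^'d \<Rightarrow> real^'d) \<Rightarrow> real"
    and \<nu> \<nu>\<^sub>m \<alpha> \<beta> h \<Delta>t T Ci Cs :: real and k J M j :: nat
  assumes dim: "CARD('d) = 2 \<or> CARD('d) = 3"
    and domain: "convex_polytopal_domain \<Omega>"
    and mesh: "mesh_of \<Omega> \<T>" and h: "h = mesh_size \<T>"
    and k: "k \<ge> 1"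
    and Xh: "Xh = velocity_space \<Omega> \<T> k"
    and Qh: "Qh = pressure_space \<Omega> \<T> (k - 1) \<or> Qh = cont_pressure_space \<Omega> \<T> (k - 1)"
    and inf_sup: "\<beta> > 0" "inf_sup \<Omega> Xh Qh \<beta>"
    and Vh: "Vh = Vsp \<Omega> Xh Qh"
    and div_free: "\<And>u. u \<in> Vh \<Longrightarrow> AE x in lebesgue_on \<Omega>. dvg \<Omega> u x = 0"
    and viscosities: "\<nu> > 0" "\<nu>\<^sub>m > 0"
    and alpha: "\<alpha> = \<nu> + \<nu>\<^sub>m - \<bar>\<nu> - \<nu>\<^sub>m\<bar>" "\<alpha> > 0"
    and time: "\<Delta>t > 0" "M \<ge> 1" "T = real M * \<Delta>t"
    and ensemble: "J \<ge> 1"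
    and forcing: "\<And>i. i \<in> {1..J} \<Longrightarrow> f\<^sub>1 i \<in> Linf_Hminus1 \<Omega> T"
                 "\<And>i. i \<in> {1..J} \<Longrightarrow> f\<^sub>2 i \<in> Linf_Hminus1 \<Omega> T"
    and inverse_ineq: "\<And>u. u \<in> Xh \<Longrightarrow> nrm \<Omega> (grad \<Omega> u) \<le> Ci * inverse h * nrm \<Omega> u"
    and trilinear: "\<And>a b c. a \<in> Xsp \<Omega> \<Longrightarrow> b \<in> Xsp \<Omega> \<Longrightarrow> c \<in> Xsp \<Omega> \<Longrightarrow>
        \<bar>ip \<Omega> (conv \<Omega> a b) c\<bar> \<le> Cs * nrm \<Omega> (grad \<Omega> a) * nrm \<Omega> (grad \<Omega> b) * nrm \<Omega> (grad \<Omega> c)"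
    and scheme: "scheme_solution \<Omega> Vh J M \<Delta>t \<nu> \<nu>\<^sub>m f\<^sub>1 f\<^sub>2 v w"
    and time_step: "\<And>n. n \<in> {1..M-1} \<Longrightarrow> dt_denominator \<Omega> J \<nu> \<nu>\<^sub>m Ci Cs v w n \<noteq> 0 \<Longrightarrow>
        \<Delta>t \<le> \<alpha> * h\<^sup>2 / dt_denominator \<Omega> J \<nu> \<nu>\<^sub>m Ci Cs v w n"
    and j: "j \<in> {1..J}"
  shows "(nrm \<Omega> (v j M))\<^sup>2 + (nrm \<Omega> (w j M))\<^sup>2
         + (nrm \<Omega> (\<lambda>x. 2 *\<^sub>R v j M x - v j (M - 1) x))\<^sup>2
         + (nrm \<Omega> (\<lambda>x. 2 *\<^sub>R w j M x - w j (M - 1) x))\<^sup>2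
         + \<alpha> * \<Delta>t * (\<Sum>n=1..M-1. (nrm \<Omega> (grad \<Omega> (v j (n + 1))))\<^sup>2 + (nrm \<Omega> (grad \<Omega> (w j (n + 1))))\<^sup>2)
       \<le> (nrm \<Omega> (v j 1))\<^sup>2 + (nrm \<Omega> (w j 1))\<^sup>2
         + (nrm \<Omega> (\<lambda>x. 2 *\<^sub>R v j 1 x - v j 0 x))\<^sup>2
         + (nrm \<Omega> (\<lambda>x. 2 *\<^sub>R w j 1 x - w j 0 x))\<^sup>2
         + 12 * \<Delta>t / \<alpha> * (\<Sum>n=1..M-1. (dual_norm \<Omega> (f\<^sub>1 j (real (n + 1) * \<Delta>t)))\<^sup>2
                                     + (dual_norm \<Omega> (f\<^sub>2 j (real (n + 1) * \<Delta>t)))\<^sup>2)"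
proof -
  have bounded: "bounded \<Omega>"
    using domain polytope_imp_bounded bounded_subset closure_subset
    unfolding convex_polytopal_domain_def by blast
  interpret bounded_open \<Omega>
    by unfold_locales (use domain bounded in \<open>auto simp: convex_polytopal_domain_def\<close>)
  have VX: "u \<in> Xh" "u \<in> Xsp \<Omega>" "u \<in> advecting" if "u \<in> Vh" for u
  proof -
    show "u \<in> Xh" using that unfolding Vh Vsp_def by blast
    then show "u \<in> Xsp \<Omega>" unfolding Xh velocity_space_def by blast
    show "u \<in> advecting"
      using velocity_space_advecting[OF \<open>u \<in> Xh\<close>[unfolded Xh] div_free[OF that]] .
  qed
  have sol: "v i m \<in> Vh" "w i m \<in> Vh" if "i \<in> {1..J}" "m \<le> M" for i m
  proof -
    consider "m = 0" | "m = 1" | "m \<ge> 2" by linarith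
    then have "v i m \<in> Vh \<and> w i m \<in> Vh"
    proof cases
      case 3
      then have "m - 1 \<in> {1..M - 1}" "m - 1 + 1 = m" using that(2) by auto
      then show ?thesis using scheme that(1) unfolding scheme_solution_def by metis
    qed (use scheme that(1) in \<open>simp_all add: scheme_solution_def\<close>)
    then show "v i m \<in> Vh" "w i m \<in> Vh" by auto
  qed
  define E where "E m = (nrm \<Omega> (v j m))\<^sup>2 + (nrm \<Omega> (w j m))\<^sup>2
         + (nrm \<Omega> (\<lambda>x. 2 *\<^sub>R v j m x - v j (m - 1) x))\<^sup>2
         + (nrm \<Omega> (\<lambda>x. 2 *\<^sub>R w j m x - w j (m - 1) x))\<^sup>2" for m
  define G where "G n = (nrm \<Omega> (grad \<Omega> (v j (n + 1))))\<^sup>2 + (nrm \<Omega> (grad \<Omega> (w j (n + 1))))\<^sup>2" for n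
  define F where "F n = (dual_norm \<Omega> (f\<^sub>1 j (real (n + 1) * \<Delta>t)))\<^sup>2
      + (dual_norm \<Omega> (f\<^sub>2 j (real (n + 1) * \<Delta>t)))\<^sup>2" for n
  have step: "E (n + 1) + \<alpha> * \<Delta>t * G n \<le> E n + 12 * \<Delta>t / \<alpha> * F n" if n: "n \<in> {1..M-1}" for n
  proof -
    have nM: "n + 1 \<le> M" "n \<le> M" "n - 1 \<le> M" using n by auto
    note v = sol(1)[OF j nM(1)] sol(1)[OF j nM(2)] sol(1)[OF j nM(3)]
    note w = sol(2)[OF j nM(1)] sol(2)[OF j nM(2)] sol(2)[OF j nM(3)]
    define W where "W = Max (\<Union>j\<in>{1..J}. {(nrm \<Omega> (grad \<Omega> (fluct J v j n)))\<^sup>2, (nrm \<Omega> (grad \<Omega> (fluct J w j n)))\<^sup>2})"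
    have W: "(nrm \<Omega> (grad \<Omega> (fluct J v j n)))\<^sup>2 \<le> W" "(nrm \<Omega> (grad \<Omega> (fluct J w j n)))\<^sup>2 \<le> W"
      unfolding W_def by (rule Max_ge; use j in auto)+
    then have "W \<ge> 0" by (meson order_trans zero_le_power2)
    \<comment> \<open>the denominator of the time step restriction without the inverse constant\<close>
    let ?S = "3 * (\<nu> - \<nu>\<^sub>m)\<^sup>2 + 12 * Cs\<^sup>2 * W"
    have S: "?S \<ge> 0" using \<open>W \<ge> 0\<close> by simp
    have den: "dt_denominator \<Omega> J \<nu> \<nu>\<^sub>m Ci Cs v w n = ?S * Ci\<^sup>2"
      unfolding dt_denominator_def W_def[symmetric] by (simp add: algebra_simps)
    have absorb: "\<Delta>t / \<alpha> * ?S * (nrm \<Omega> (grad \<Omega> (second_diff u j n)))\<^sup>2 \<le> (nrm \<Omega> (second_diff u j n))\<^sup>2"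
      if "u j (n + 1) \<in> Vh" "u j n \<in> Vh" "u j (n - 1) \<in> Vh" for u
    proof (rule time_step_absorbs[OF alpha(2) time(1) S nrm_nonneg])
      show "nrm \<Omega> (grad \<Omega> (second_diff u j n)) \<le> Ci * inverse h * nrm \<Omega> (second_diff u j n)"
        by (rule inverse_ineq)
          (use velocity_space_second_diff that[THEN VX(1)] in \<open>unfold Xh, blast\<close>)
      show "?S * Ci\<^sup>2 \<noteq> 0 \<Longrightarrow> \<Delta>t \<le> \<alpha> * h\<^sup>2 / (?S * Ci\<^sup>2)"
        using time_step[OF n] unfolding den .
    qed
    have "real (n + 1) * \<Delta>t \<in> {0<..T}"
    proof -
      have "real (n + 1) * \<Delta>t \<le> real M * \<Delta>t"
        using nM(1) time(1) by (intro mult_right_mono) (simp_all only: of_nat_le_iff less_imp_le)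
      then show ?thesis using time by simp
    qed
    then have H: "f\<^sub>1 j (real (n + 1) * \<Delta>t) \<in> Hminus1 \<Omega>" "f\<^sub>2 j (real (n + 1) * \<Delta>t) \<in> Hminus1 \<Omega>"
      using forcing[OF j] unfolding Linf_Hminus1_def mem_Collect_eq by blast+
    have adv: "\<And>i. i \<in> {1..J} \<Longrightarrow> v i n \<in> advecting \<and> v i (n - 1) \<in> advecting"
      "\<And>i. i \<in> {1..J} \<Longrightarrow> w i n \<in> advecting \<and> w i (n - 1) \<in> advecting"
      using sol nM VX(3) by blast+
    have eqs: "step_eq \<Omega> Vh J \<Delta>t \<nu> \<nu>\<^sub>m f\<^sub>1 v w j n" "step_eq \<Omega> Vh J \<Delta>t \<nu> \<nu>\<^sub>m f\<^sub>2 w v j n"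
      using scheme n j unfolding scheme_solution_def by blast+
    note V = one_equation_energy[OF alpha(2) time(1) trilinear eqs(1) v(1) v[THEN VX(2)] w[THEN VX(2)]
        ens_mean_advecting[where n=n and b=w, OF ensemble adv(2)]
        fluct_advecting[where n=n and b=w, OF ensemble adv(2) j] H(1) W(2)]
    note W' = one_equation_energy[OF alpha(2) time(1) trilinear eqs(2) w(1) w[THEN VX(2)] v[THEN VX(2)]
        ens_mean_advecting[where n=n and b=v, OF ensemble adv(1)]
        fluct_advecting[where n=n and b=v, OF ensemble adv(1) j] H(2) W(1)]
    from add_equation_energies[OF alpha V W' absorb[of v, OF v] absorb[of w, OF w]]
    show ?thesis
      unfolding bdf2_identity[OF v[THEN VX(2), THEN Xsp_L2]] bdf2_identity[OF w[THEN VX(2), THEN Xsp_L2]]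
        E_def G_def F_def second_diff_def[abs_def]
      by simp
  qed
  have "E m + \<alpha> * \<Delta>t * (\<Sum>n=1..m-1. G n) \<le> E 1 + 12 * \<Delta>t / \<alpha> * (\<Sum>n=1..m-1. F n)"
    if "1 \<le> m" "m \<le> M" for m
    using that
  proof (induction m rule: nat_induct_at_least)
    case (Suc m)
    have "E (m + 1) + \<alpha> * \<Delta>t * G m \<le> E m + 12 * \<Delta>t / \<alpha> * F m"
      using Suc by (intro step) auto
    moreover have "(\<Sum>n=1..Suc m - 1. H n) = (\<Sum>n=1..m-1. H n) + H m" for H :: "nat \<Rightarrow> real"
      using Suc.hyps by (cases m) auto
    ultimately show ?case using Suc by (simp add: distrib_left)
  qed simp
  from this[OF time(2) order_refl] show ?thesis by (simp add: E_def G_def F_def)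
qed

end
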